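(* Let $n\geq 4$, let $I\subset\{0,1,\ldots,n\}$ with $0,n\notin I$, and let $\mathcal{X}=2^{n+1}_I$ be the premaniplex of rank $n+1$ with two vertices, which has links of colors $0$ and $n$. Let $\xi$ be the voltage assignment on $\mathcal{X}$, with values in the permutations of the flags of $\mathcal{M}_n$, defined in the context. Then for every $k>1$ (with $k\leq n$), every $m\in[0,n]$, and all pairs of vertices $(a,b)$ of $\mathcal{X}$ (possibly equal), $$\xi(\Pi^{a,b}_{[0,m]}(\mathcal{X}))\cap\xi(\Pi^{a,b}_{[k,n]}(\mathcal{X}))=\xi(\Pi^{a,b}_{[k,m]}(\mathcal{X})).$$
   Context: Premaniplexes. For $I\subsetneq\{0,\ldots,n\}$, $2^{n+1}_I$ is the graph with two vertices (one called white, the other black) having, for each color $i\in I$, a semi-edge of color $i$ at each vertex and, for each color $i\in\{0,\ldots,n\}\setminus I$, a link (edge with two distinct endpoints) of color $i$ joining the two vertices. A dart is an oriented edge; a link has two mutually inverse darts, a semi-edge has one dart, which is its own inverse. Paths are sequences of consecutive darts, considered up to homotopy (insertion/deletion of consecutive inverse darts). $[k,m]=\{k,k+1,\ldots,m\}$ (empty if $k>m$), and $\Pi^{a,b}_{J}(\mathcal{X})$ is the set of (homotopy classes of) paths from $a$ to $b$ using only darts with colors in $J$; the empty path at a vertex is allowed, so $\xi(\Pi^{a,b}_\emptyset)$ is the trivial group if $a=b$ and empty if $a\neq b$. Maniplexes. An $n$-maniplex is a connected simple graph (vertices are called flags) with edges colored by $\{0,\ldots,n-1\}$ such that each vertex is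 incident to exactly one edge of each color and, for $|i-j|>1$, alternating paths of length 4 in colors $i,j$ are closed. $\Phi^i$ is the $i$-neighbor of $\Phi$; $r_i$ is the permutation $\Phi\mapsto\Phi^i$; the $r_i$ generate the monodromy group. $i$-faces are the connected components after deleting color $i$, with facets being $(n-1)$-faces; faces are incident if they intersect, and $F\le G$ if they are incident and the rank of $F$ is at most that of $G$; formal least and greatest faces are added. Automorphisms are color-preserving graph automorphisms. Automorphisms and flag permutations act on the right. $(\Phi)_i$ is the $i$-face of the flag $\Phi$. The family $\mathcal{M}_n$. For an $r$-maniplex $\mathcal{M}$ with facet set $\mathrm{Fac}(\mathcal{M})$, $\hat{2}^{\mathcal{M}}$ is the $(r+1)$-maniplex with flags $(\Phi,x)$, $\Phi$ a flag of $\mathcal{M}$ and $x\in\mathbb{Z}_2^{\mathrm{Fac}(\mathcal{M})}$, with $(\Phi,x)^i=(\Phi^i,x)$ for $i<r$ and $(\Phi,x)^r=(\Phi,x+\chi_{\mathrm{Fac}(\Phi)})$, where $\mathrm{Fac}(\Phi)$ is the facet of $\Phi$ and $\chi_F$ is the characteristic function of $F$. $\mathcal{M}_2$ is the flag-graph of a square and $\mathcal{M}_{j+1}=\hat{2}^{\mathcal{M}_j}$; each $\mathcal{M}_j$ is the flag-graph of a regular polytope. The support $\mathrm{supp}(x)$ is the set of facets $F$ with $x(F)=1$. The $i$-faces of $\mathcal{M}_n=\hat{2}^{\mathcal{M}_{n-1}}$ ($i\le n-1$) are the classes of pairs $(F,x)$, $F$ an $i$-face of $\mathcal{M}_{n-1}$,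 where $(F,x)\sim(F',x')$ iff $F=F'$ and every $G\in\mathrm{supp}(x+x')$ satisfies $F\le G$. If $f_{n-1}$ is the greatest face of $\mathcal{M}_{n-1}$, the facets of $\mathcal{M}_n$ are $(f_{n-1},x)$, consisting of the flags $(\psi,x)$ with $x$ fixed; the base facet is $(f_{n-1},0)$. The sets $S_j$. $S_3$ is a fixed set of facets of $\mathcal{M}_3$ (the map $\{4,4\}_{(4,0)}$, a $4\times4$ toroidal chessboard) that is not invariant under any non-trivial automorphism of $\mathcal{M}_3$ and that is not contained in the union of the sets of facets incident to $u$ and to $v$, for any two 0-faces $u,v$. For $j\geq4$, $S_j=\{(f_{j-1},\chi_F):F\in S_{j-1}\}\cup\{(f_{j-1},0)\}$, with $f_{j-1}$ the greatest face of $\mathcal{M}_{j-1}$. No $S_j$ is invariant under a non-trivial automorphism of $\mathcal{M}_j$. Base edges and $\widetilde{\rho}_0$ ($n\ge4$). Fix a base flag of $\mathcal{M}_{n-1}$ with 1-face $e$. The base edge of the facet $(f_{n-1},x)$ of $\mathcal{M}_n$ is $(e\gamma,x)$ if $\mathrm{supp}(x)=S_{n-1}\gamma$ for some (necessarily unique) automorphism $\gamma$ of $\mathcal{M}_{n-1}$, and $(e,x)$ otherwise. For each facet $F$ of $\mathcal{M}_n$ choose a flag $\Phi_F$ in $F$ whose 1-face is the base edge of $F$. $\widetilde{\rho}_0$ is the permutation of the flags of $\mathcal{M}_n$ that preserves each facet $F$ and acts on it as the automorphism of $F$ (preserving colors $0,\ldots,n-2$) sending $\Phi_F$ to $\Phi_F^0$;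 this does not depend on the choice of $\Phi_F$. Put $y_n=\widetilde{\rho}_0r_0$, an involution. The voltage assignment $\xi$ (with $r_i$ the generators of the monodromy group of $\mathcal{M}_n$): $\xi(d)=1$ if $d$ has color 0; $\xi(d)=y_n$ if $d$ has color $n$; and for $d$ of color $i\in[1,n-1]$: $\xi(d)=r_i$ if $d$ is a semi-edge at the white vertex, $\xi(d)=r_0r_ir_0$ if $d$ is a semi-edge at the black vertex, $\xi(d)=r_0r_i$ if $d$ goes from white to black, $\xi(d)=r_ir_0$ if $d$ goes from black to white. It is extended to paths by $\xi(d_1d_2\cdots d_q)=\xi(d_q)\cdots\xi(d_2)\xi(d_1)$. *)

theory Defs
  imports Main "HOL-Library.FSet" "HOL-Combinatorics.Permutations"
begin

section \<open>Maniplexes\<close>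

text \<open>An edge-coloured graph in which every flag is incident to exactly one edge of each colour
  \<open>i < rank\<close> is given by its neighbour functions: \<open>nbr M i \<Phi>\<close> is the \<open>i\<close>-neighbour of \<open>\<Phi>\<close>.
  The values of \<open>nbr\<close> off \<open>flags M\<close>, and for colours \<open>i \<ge> rank M\<close>, carry no meaning.\<close>

record 'f maniplex =
  rank :: nat
  flags :: "'f set"
  nbr :: "nat \<Rightarrow> 'f \<Rightarrow> 'f"

definition face :: "'f maniplex \<Rightarrow> nat \<Rightarrow> 'f \<Rightarrow> 'f set" where
  "face M i \<Phi> =
     {\<Psi>. (\<Phi>, \<Psi>) \<in> {(\<Theta>, nbr M j \<Theta>) | \<Theta> j. \<Theta> \<in> flags M \<and> j < rank M \<and> j \<noteq> i}\<^sup>*}"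

definition faces :: "'f maniplex \<Rightarrow> nat \<Rightarrow> 'f set set" where
  "faces M i = face M i ` flags M"

abbreviation facet_of :: "'f maniplex \<Rightarrow> 'f \<Rightarrow> 'f set" where
  "facet_of M \<equiv> face M (rank M - 1)"

abbreviation facets :: "'f maniplex \<Rightarrow> 'f set set" where
  "facets M \<equiv> faces M (rank M - 1)"

definition incident :: "'f set \<Rightarrow> 'f set \<Rightarrow> bool" where
  "incident F G \<longleftrightarrow> F \<inter> G \<noteq> {}"

definition automorphism :: "'f maniplex \<Rightarrow> ('f \<Rightarrow> 'f) \<Rightarrow> bool" where
  "automorphism M \<gamma> \<longleftrightarrow> \<gamma> permutes flags M \<and>
     (\<forall>\<Phi>\<in>flags M. \<forall>i<rank M. \<gamma> (nbr M i \<Phi>) = nbr M i (\<gamma> \<Phi>))"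

text \<open>Permutations of the flags are functions that are the identity off \<open>flags M\<close>.\<close>

definition monodromy_gen :: "'f maniplex \<Rightarrow> nat \<Rightarrow> 'f \<Rightarrow> 'f" where
  "monodromy_gen M i \<Phi> = (if \<Phi> \<in> flags M then nbr M i \<Phi> else \<Phi>)"

text \<open>Permutations act on the right, so in the product \<open>\<alpha> \<odot> \<beta>\<close> the factor \<open>\<alpha>\<close> is applied first.\<close>

definition rprod :: "('f \<Rightarrow> 'f) \<Rightarrow> ('f \<Rightarrow> 'f) \<Rightarrow> 'f \<Rightarrow> 'f" (infixl "\<odot>" 70) where
  "\<alpha> \<odot> \<beta> = \<beta> \<circ> \<alpha>"

section \<open>The family $\mathcal{M}_n$\<close>

text \<open>One type has to hold the flags of all the \<open>\<M> n\<close>. \<open>Sq v e\<close> is the flag of the square with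
  vertices and edges numbered by \<open>0, \<dots>, 3\<close>, edge \<open>e\<close> joining the vertices \<open>e\<close> and \<open>e + 1\<close> modulo 4.
  \<open>Ext \<Phi> x\<close> is the flag \<open>(\<Phi>, x)\<close> of $\hat{2}^{\mathcal{M}}$, where the vector \<open>x\<close> over the
  two-element field, indexed by the facets of \<open>M\<close>, is given by its support. A facet, being a set
  of flags, occurs in \<open>x\<close> as an \<^typ>\<open>'a fset\<close> because a datatype cannot recurse through
  \<^typ>\<open>'a set\<close>; all the facets concerned are finite.\<close>

datatype flag = Sq nat nat | Ext flag "flag fset fset"

type_synonym vec = "flag fset fset"

definition supp :: "vec \<Rightarrow> flag set set" where
  "supp x = fset ` fset x"

definition chi :: "flag set \<Rightarrow> vec" where
  "chi F = {|Abs_fset F|}"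

definition vzero :: vec where
  "vzero = {||}"

definition vplus :: "vec \<Rightarrow> vec \<Rightarrow> vec" where
  "vplus x y = (x |-| y) |\<union>| (y |-| x)"

definition square :: "flag maniplex" where
  "square =
     \<lparr>rank = 2,
      flags = {Sq v e | v e. e < 4 \<and> (v = e \<or> v = Suc e mod 4)},
      nbr = (\<lambda>i \<Psi>. case \<Psi> of
          Sq v e \<Rightarrow> if i = 0 then Sq (if v = e then Suc e mod 4 else e) e
                    else Sq v (if e = v then (v + 3) mod 4 else v)
        | Ext \<Phi> x \<Rightarrow> Ext \<Phi> x)\<rparr>"

definition hat2 :: "flag maniplex \<Rightarrow> flag maniplex" where
  "hat2 M =
     \<lparr>rank = Suc (rank M),
      flags = {Ext \<Phi> x | \<Phi> x. \<Phi> \<in> flags M \<and> supp x \<subseteq> facets M},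
      nbr = (\<lambda>i \<Psi>. case \<Psi> of
          Sq v e \<Rightarrow> Sq v e
        | Ext \<Phi> x \<Rightarrow> if i < rank M then Ext (nbr M i \<Phi>) x
                      else Ext \<Phi> (vplus x (chi (facet_of M \<Phi>))))\<rparr>"

text \<open>Meaningful for \<open>n \<ge> 2\<close> only.\<close>

definition Mfam :: "nat \<Rightarrow> flag maniplex" ("\<M>") where
  "\<M> n = (hat2 ^^ (n - 2)) square"

text \<open>The face \<open>(F, x)\<close> of \<open>hat2 M\<close> for a proper face \<open>F\<close> of \<open>M\<close>, as the set of its flags: the flags
  \<open>(\<Phi>, x')\<close> with \<open>\<Phi>\<close> in \<open>F\<close> and \<open>(F, x') \<sim> (F, x)\<close>. The rank condition in \<open>F \<le> G\<close> holds
  automatically as \<open>G\<close> is a facet.\<close>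

definition hat_face :: "flag maniplex \<Rightarrow> flag set \<Rightarrow> vec \<Rightarrow> flag set" where
  "hat_face M F x =
     {Ext \<Phi> x' | \<Phi> x'. \<Phi> \<in> F \<and> supp x' \<subseteq> facets M \<and> (\<forall>G\<in>supp (vplus x x'). incident F G)}"

text \<open>The facet of \<open>hat2 M\<close> given by the greatest face of \<open>M\<close> and the vector \<open>x\<close>.\<close>

definition hat_facet :: "flag maniplex \<Rightarrow> vec \<Rightarrow> flag set" where
  "hat_facet M x = {Ext \<Phi> x | \<Phi>. \<Phi> \<in> flags M}"

section \<open>The sets $S_j$\<close>

definition facet_act :: "('f \<Rightarrow> 'f) \<Rightarrow> 'f set set \<Rightarrow> 'f set set" where
  "facet_act \<gamma> S = (\<lambda>F. \<gamma> ` F) ` S"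

definition admissible_S3 :: "flag set set \<Rightarrow> bool" where
  "admissible_S3 S \<longleftrightarrow>
     S \<subseteq> facets (\<M> 3) \<and>
     (\<forall>\<gamma>. automorphism (\<M> 3) \<gamma> \<and> facet_act \<gamma> S = S \<longrightarrow> \<gamma> = id) \<and>
     (\<forall>u\<in>faces (\<M> 3) 0. \<forall>v\<in>faces (\<M> 3) 0.
        \<not> S \<subseteq> {F \<in> facets (\<M> 3). incident F u} \<union> {F \<in> facets (\<M> 3). incident F v})"

text \<open>\<open>Sfam S3 j\<close> is $S_j$ for \<open>j \<ge> 3\<close>, built from $S_3$.\<close>

fun Sfam :: "flag set set \<Rightarrow> nat \<Rightarrow> flag set set" where
  "Sfam S3 j =
     (if j \<le> 3 then S3
      else (\<lambda>F. hat_facet (\<M> (j - 1)) (chi F)) ` Sfam S3 (j - 1) \<union> {hat_facet (\<M> (j - 1)) vzero})"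

declare Sfam.simps [simp del]

section \<open>Base edges, $\widetilde{\rho}_0$ and $y_n$\<close>

text \<open>The base edge of the facet of \<open>\<M> n\<close> with vector \<open>x\<close>; \<open>\<Phi>0\<close> is the base flag of \<open>\<M> (n - 1)\<close>.\<close>

definition base_edge :: "nat \<Rightarrow> flag set set \<Rightarrow> flag \<Rightarrow> vec \<Rightarrow> flag set" where
  "base_edge n S3 \<Phi>0 x =
     (let N = \<M> (n - 1);
          e = face N 1 \<Phi>0;
          P = (\<lambda>\<gamma>. automorphism N \<gamma> \<and> supp x = facet_act \<gamma> (Sfam S3 (n - 1)))
      in if \<exists>\<gamma>. P \<gamma> then hat_face N ((SOME \<gamma>. P \<gamma>) ` e) x else hat_face N e x)"

text \<open>\<open>c\<close> picks in each facet \<open>F\<close> of \<open>\<M> n\<close> a flag $\Phi_F$ whose 1-face is the base edge of \<open>F\<close>.\<close>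

definition base_flag_choice :: "nat \<Rightarrow> flag set set \<Rightarrow> flag \<Rightarrow> (flag set \<Rightarrow> flag) \<Rightarrow> bool" where
  "base_flag_choice n S3 \<Phi>0 c \<longleftrightarrow>
     (\<forall>x. supp x \<subseteq> facets (\<M> (n - 1)) \<longrightarrow>
        (let F = hat_facet (\<M> (n - 1)) x
         in c F \<in> F \<and> face (\<M> n) 1 (c F) = base_edge n S3 \<Phi>0 x))"

definition rho0 :: "nat \<Rightarrow> (flag set \<Rightarrow> flag) \<Rightarrow> flag \<Rightarrow> flag" where
  "rho0 n c =
     (THE \<rho>. \<rho> permutes flags (\<M> n) \<and>
        (\<forall>F\<in>facets (\<M> n). \<rho> ` F = F \<and>
           (\<forall>\<Phi>\<in>F. \<forall>i\<le>n - 2. \<rho> (nbr (\<M> n) i \<Phi>) = nbr (\<M> n) i (\<rho> \<Phi>)) \<and>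
           \<rho> (c F) = nbr (\<M> n) 0 (c F)))"

definition y_perm :: "nat \<Rightarrow> (flag set \<Rightarrow> flag) \<Rightarrow> flag \<Rightarrow> flag" where
  "y_perm n c = rho0 n c \<odot> monodromy_gen (\<M> n) 0"

section \<open>The premaniplex $2^{n+1}_I$\<close>

datatype vertex = White | Black

text \<open>Every vertex is the starting point of exactly one dart of each colour \<open>i \<le> n\<close>, so the dart of
  colour \<open>i\<close> starting at \<open>v\<close> is the pair \<open>(v, i)\<close>: a semi-edge if \<open>i \<in> I\<close>, and otherwise one of the
  two darts of the link of colour \<open>i\<close>.\<close>

type_synonym dart = "vertex \<times> nat"

definition darts :: "nat \<Rightarrow> dart set" where
  "darts n = UNIV \<times> {0..n}"

fun opposite :: "vertex \<Rightarrow> vertex" where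
  "opposite White = Black"
| "opposite Black = White"

definition dart_end :: "nat set \<Rightarrow> dart \<Rightarrow> vertex" where
  "dart_end I d = (if snd d \<in> I then fst d else opposite (fst d))"

definition dart_inv :: "nat set \<Rightarrow> dart \<Rightarrow> dart" where
  "dart_inv I d = (dart_end I d, snd d)"

fun is_walk :: "nat \<Rightarrow> nat set \<Rightarrow> vertex \<Rightarrow> dart list \<Rightarrow> vertex \<Rightarrow> bool" where
  "is_walk n I a [] b \<longleftrightarrow> a = b"
| "is_walk n I a (d # w) b \<longleftrightarrow> d \<in> darts n \<and> fst d = a \<and> is_walk n I (dart_end I d) w b"

definition homotopy :: "nat \<Rightarrow> nat set \<Rightarrow> vertex \<Rightarrow> vertex \<Rightarrow> (dart list \<times> dart list) set" where
  "homotopy n I a b =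
     (let R = {(u @ v, u @ [d, dart_inv I d] @ v) | u d v.
                 is_walk n I a (u @ v) b \<and> is_walk n I a (u @ [d, dart_inv I d] @ v) b}
      in (R \<union> R\<inverse>)\<^sup>*)"

text \<open>The homotopy classes that contain a path using only darts with colours in \<open>J\<close>.\<close>

definition paths :: "nat \<Rightarrow> nat set \<Rightarrow> vertex \<Rightarrow> vertex \<Rightarrow> nat set \<Rightarrow> dart list set set" where
  "paths n I a b J = {homotopy n I a b `` {w} | w. is_walk n I a w b \<and> snd ` set w \<subseteq> J}"

section \<open>The voltage assignment\<close>

definition voltage :: "nat \<Rightarrow> nat set \<Rightarrow> (flag set \<Rightarrow> flag) \<Rightarrow> dart \<Rightarrow> flag \<Rightarrow> flag" where
  "voltage n I c d =
     (let r = monodromy_gen (\<M> n); i = snd d in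
      if i = 0 then id
      else if i = n then y_perm n c
      else if i \<in> I then (case fst d of White \<Rightarrow> r i | Black \<Rightarrow> r 0 \<odot> r i \<odot> r 0)
      else (case fst d of White \<Rightarrow> r 0 \<odot> r i | Black \<Rightarrow> r i \<odot> r 0))"

fun walk_voltage :: "nat \<Rightarrow> nat set \<Rightarrow> (flag set \<Rightarrow> flag) \<Rightarrow> dart list \<Rightarrow> flag \<Rightarrow> flag" where
  "walk_voltage n I c [] = id"
| "walk_voltage n I c (d # w) = walk_voltage n I c w \<odot> voltage n I c d"

text \<open>The set of voltages of a set of homotopy classes; homotopic paths have equal voltage.\<close>

definition voltages :: "nat \<Rightarrow> nat set \<Rightarrow> (flag set \<Rightarrow> flag) \<Rightarrow> dart list set set \<Rightarrow> (flag \<Rightarrow> flag) set" where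
  "voltages n I c P = (\<Union>C\<in>P. walk_voltage n I c ` C)"

end

theory Submission
  imports Defs
begin

text \<open>Let \<open>r i\<close>, for \<open>i < n\<close>, be the generators of the monodromy group of \<open>\<M> n\<close> and let \<open>r n\<close> stand
  for $\widetilde{\rho}_0$. Up to factors that depend on the two ends only, the voltage of a path
  is the product of the \<open>r i\<close> over its colours \<open>i\<close> (\<open>walk_voltage_eq\<close>); the end of a path is given by
  its beginning and the parity of the number of its colours outside \<open>I\<close>. So two words, one in the
  colours \<open>[0,m]\<close> and the other in \<open>[k,n]\<close>, that give the same permutation have to be replaced by a
  word in \<open>[k,m]\<close> that gives this permutation and has the same parity (\<open>gens_meet\<close>). This is
  immediate for \<open>m = n\<close>.

  Let \<open>m < n\<close>, put \<open>N = \<M> (n - 1)\<close>, and follow the second word, \<open>v\<close>, from a flag \<open>(\<Phi>, 0)\<close>. Let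
  \<open>\<rho>\<close> be the automorphism of \<open>N\<close> that reverses the base edge \<open>e\<close> at the base flag. A vector
  supported on facets at the vertex of \<open>\<Phi>\<close> or at the vertex of \<open>\<rho> \<Phi>\<close> is never an image of
  $S_{n-1}$, as no two vertices cover that set (\<open>Sfam_uncovered\<close>); so the base edge of the facet
  with this vector lies over \<open>e\<close>, and $\widetilde{\rho}_0$ acts there as \<open>\<rho>\<close>
  (\<open>rho0_covered\<close>). As the letters of \<open>v\<close> are at least 2, the flag of \<open>N\<close> stays at one of these two
  vertices, only facets at them are added to the vector, and the situation persists
  (\<open>gens_from_zero\<close>). Two consequences follow.

  First, the letter \<open>n\<close> occurs an even number of times in \<open>v\<close> (\<open>even_number_of_reflections\<close>).
  Otherwise comparison with the first word shows that \<open>\<rho>\<close> acts on all flags of \<open>N\<close> as a fixed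
  word; by regularity this word acts as \<open>r 0\<close>, the two being equal at the base flag; but \<open>\<rho>\<close>
  commutes with \<open>r 1\<close>, and \<open>r 0\<close> does not. Secondly, from the base flag with zero vector \<open>\<rho>\<close> acts
  as \<open>r 0\<close>, which commutes with the other letters of \<open>v\<close>, so that \<open>v\<close> acts as \<open>v\<close> without its letters
  \<open>n\<close> (\<open>gens_from_base_flag\<close>). Now the intersection property of the polytope \<open>\<M> n\<close> yields a word
  in \<open>[k,m]\<close> that agrees with the first word at this flag, hence, by regularity, everywhere. The
  parities agree because, for every set of colours, the flags of \<open>\<M> n\<close> have a 2-colouring that
  changes exactly along the edges with colours in this set.\<close>

section \<open>Regular polytopes with two-colourable flag graphs\<close>

text \<open>Words act with their last letter first, as do the darts of a path in its voltage.\<close>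

abbreviation act :: "'f maniplex \<Rightarrow> nat list \<Rightarrow> 'f \<Rightarrow> 'f" where
  "act M \<equiv> foldr (nbr M)"

text \<open>The properties of the maniplexes \<open>\<M> n\<close> that the proof uses, chosen so that the square has
  them and \<open>hat2\<close> preserves them. The meet property is the intersection property of a polytope,
  expressed by words that start at one flag, for the intervals \<open>[0,m]\<close> and \<open>[k,rank)\<close> of colours.
  The last property implies that in any closed word every colour occurs an even number of times.\<close>

locale regular_even_polytope =
  fixes M :: "'f maniplex"
  assumes rank_ge_2: "2 \<le> rank M"
    and finite_flags: "finite (flags M)"
    and flags_nonempty: "flags M \<noteq> {}"
    and nbr_in: "\<Phi> \<in> flags M \<Longrightarrow> i < rank M \<Longrightarrow> nbr M i \<Phi> \<in> flags M"
    and nbr_nbr: "\<Phi> \<in> flags M \<Longrightarrow> i < rank M \<Longrightarrow> nbr M i (nbr M i \<Phi>) = \<Phi>"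
    and nbr_commute: "\<Phi> \<in> flags M \<Longrightarrow> i + 2 \<le> j \<Longrightarrow> j < rank M
          \<Longrightarrow> nbr M i (nbr M j \<Phi>) = nbr M j (nbr M i \<Phi>)"
    and nbr_0_1_not_commute:
          "\<Phi> \<in> flags M \<Longrightarrow> nbr M 0 (nbr M 1 \<Phi>) \<noteq> nbr M 1 (nbr M 0 \<Phi>)"
    and connected: "\<Phi> \<in> flags M \<Longrightarrow> \<Psi> \<in> flags M
          \<Longrightarrow> \<exists>w. set w \<subseteq> {..<rank M} \<and> \<Psi> = act M w \<Phi>"
    and flag_transitive: "\<Phi> \<in> flags M \<Longrightarrow> \<Psi> \<in> flags M
          \<Longrightarrow> \<exists>\<gamma>. automorphism M \<gamma> \<and> \<gamma> \<Phi> = \<Psi>"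
    and meet_property: "\<Phi> \<in> flags M \<Longrightarrow> set w \<subseteq> {..<rank M} \<Longrightarrow> set w \<subseteq> {..m}
          \<Longrightarrow> set v \<subseteq> {k..<rank M} \<Longrightarrow> act M w \<Phi> = act M v \<Phi>
          \<Longrightarrow> \<exists>u. set u \<subseteq> {k..m} \<and> set u \<subseteq> {..<rank M} \<and> act M u \<Phi> = act M w \<Phi>"
    and two_colouring:
          "\<exists>f. \<forall>\<Phi>\<in>flags M. \<forall>i<rank M. f (nbr M i \<Phi>) = (f \<Phi> \<noteq> (P i :: bool))"
begin

lemma act_in: "\<Phi> \<in> flags M \<Longrightarrow> set w \<subseteq> {..<rank M} \<Longrightarrow> act M w \<Phi> \<in> flags M"
  by (induction w) (auto simp: nbr_in)

lemma act_rev: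
  "\<Phi> \<in> flags M \<Longrightarrow> set w \<subseteq> {..<rank M} \<Longrightarrow> act M (rev w) (act M w \<Phi>) = \<Phi>"
  by (induction w) (auto simp: nbr_nbr act_in)

lemma act_rev':
  "\<Phi> \<in> flags M \<Longrightarrow> set w \<subseteq> {..<rank M} \<Longrightarrow> act M w (act M (rev w) \<Phi>) = \<Phi>"
  using act_rev[of \<Phi> "rev w"] by simp

lemma act_nbr_0:
  assumes "\<Phi> \<in> flags M" "set w \<subseteq> {..<rank M}" "1 \<notin> set w"
  shows "act M w (nbr M 0 \<Phi>) = nbr M 0 (act M w \<Phi>)"
  using assms(2,3)
proof (induction w)
  case (Cons i w)
  then have "act M w \<Phi> \<in> flags M" using act_in assms(1) by simp
  moreover have "i = 0 \<or> 2 \<le> i" using Cons.prems by (cases "i = 0") auto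
  ultimately show ?case using Cons nbr_commute[of "act M w \<Phi>" 0 i] by auto
qed simp

lemma face_eq:
  assumes "\<Phi> \<in> flags M"
  shows "face M i \<Phi> = {act M w \<Phi> | w. set w \<subseteq> {..<rank M} - {i}}"
proof -
  let ?R = "{(\<Theta>, nbr M j \<Theta>) | \<Theta> j. \<Theta> \<in> flags M \<and> j < rank M \<and> j \<noteq> i}"
  have "\<exists>w. set w \<subseteq> {..<rank M} - {i} \<and> \<Psi> = act M w \<Phi>" if "(\<Phi>, \<Psi>) \<in> ?R\<^sup>*" for \<Psi>
    using that
  proof (induction rule: rtrancl_induct)
    case base
    show ?case by (rule exI[of _ "[]"]) simp
  next
    case (step \<Psi> \<Theta>)
    then obtain w j where "set w \<subseteq> {..<rank M} - {i}" "\<Psi> = act M w \<Phi>"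
      "\<Theta> = nbr M j \<Psi>" "j < rank M" "j \<noteq> i" by auto
    then show ?case by (intro exI[of _ "j # w"]) auto
  qed
  moreover have "(\<Phi>, act M w \<Phi>) \<in> ?R\<^sup>*" if "set w \<subseteq> {..<rank M} - {i}" for w
    using that
  proof (induction w)
    case (Cons j w)
    have "set w \<subseteq> {..<rank M}" using Cons.prems by auto
    then have "act M w \<Phi> \<in> flags M" by (rule act_in[OF assms])
    then have "(act M w \<Phi>, nbr M j (act M w \<Phi>)) \<in> ?R" using Cons.prems by auto
    moreover have "(\<Phi>, act M w \<Phi>) \<in> ?R\<^sup>*" using Cons by auto
    ultimately show ?case by (simp add: rtrancl_into_rtrancl)
  qed simp
  ultimately show ?thesis unfolding face_def by blast
qed

lemma face_refl: "\<Phi> \<in> face M i \<Phi>"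
  by (simp add: face_def)

lemma act_in_face:
  "\<Phi> \<in> flags M \<Longrightarrow> set w \<subseteq> {..<rank M} \<Longrightarrow> i \<notin> set w \<Longrightarrow> act M w \<Phi> \<in> face M i \<Phi>"
  by (auto simp: face_eq)

lemma face_subset_flags: "\<Phi> \<in> flags M \<Longrightarrow> face M i \<Phi> \<subseteq> flags M"
  using act_in by (fastforce simp: face_eq)

lemma finite_face: "\<Phi> \<in> flags M \<Longrightarrow> finite (face M i \<Phi>)"
  using face_subset_flags finite_flags finite_subset by blast

lemma finite_faces: "F \<in> faces M i \<Longrightarrow> finite F"
  by (auto simp: faces_def finite_face)

lemma face_nbr_subset:
  assumes "\<Phi> \<in> flags M" "j < rank M" "j \<noteq> i"
  shows "face M i (nbr M j \<Phi>) \<subseteq> face M i \<Phi>"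
proof -
  have "act M w (nbr M j \<Phi>) \<in> face M i \<Phi>" if "set w \<subseteq> {..<rank M} - {i}" for w
    using act_in_face[of \<Phi> "w @ [j]" i] that assms by auto
  then show ?thesis by (auto simp: face_eq assms nbr_in)
qed

lemma face_nbr:
  assumes "\<Phi> \<in> flags M" "j < rank M" "j \<noteq> i"
  shows "face M i (nbr M j \<Phi>) = face M i \<Phi>"
  using face_nbr_subset[of \<Phi> j i] face_nbr_subset[of "nbr M j \<Phi>" j i] assms
  by (auto simp: nbr_in nbr_nbr)

lemma face_of_mem:
  assumes "\<Phi> \<in> flags M" "\<Psi> \<in> face M i \<Phi>"
  shows "face M i \<Psi> = face M i \<Phi>"
proof -
  obtain w where w: "set w \<subseteq> {..<rank M} - {i}" "\<Psi> = act M w \<Phi>"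
    using assms by (auto simp: face_eq)
  have "face M i (act M w \<Phi>) = face M i \<Phi>" using w(1)
  proof (induction w)
    case (Cons j w)
    have "set w \<subseteq> {..<rank M}" using Cons.prems by auto
    then have "act M w \<Phi> \<in> flags M" by (rule act_in[OF assms(1)])
    then show ?case using Cons face_nbr[of "act M w \<Phi>" j i] by auto
  qed simp
  then show ?thesis using w(2) by simp
qed

lemma incident_faces_of_flag: "incident (face M i \<Phi>) (face M j \<Phi>)"
  unfolding incident_def using face_refl by blast

lemma automorphism_in: "automorphism M \<gamma> \<Longrightarrow> \<Phi> \<in> flags M \<Longrightarrow> \<gamma> \<Phi> \<in> flags M"
  by (simp add: automorphism_def permutes_in_image)

lemma automorphism_act:
  assumes "automorphism M \<gamma>" "\<Phi> \<in> flags M" "set w \<subseteq> {..<rank M}"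
  shows "\<gamma> (act M w \<Phi>) = act M w (\<gamma> \<Phi>)"
  using assms(3)
proof (induction w)
  case (Cons j w)
  then have "act M w \<Phi> \<in> flags M" using act_in assms(2) by simp
  then show ?case using Cons assms(1) by (simp add: automorphism_def)
qed simp

lemma automorphism_image_face:
  assumes "automorphism M \<gamma>" "\<Phi> \<in> flags M"
  shows "\<gamma> ` face M i \<Phi> = face M i (\<gamma> \<Phi>)"
proof -
  have *: "\<gamma> (act M w \<Phi>) = act M w (\<gamma> \<Phi>)" if "set w \<subseteq> {..<rank M} - {i}" for w
    using automorphism_act[OF assms, of w] that by auto
  show ?thesis
    unfolding face_eq[OF assms(2)] face_eq[OF automorphism_in[OF assms]]
  proof (intro equalityI subsetI)
    fix x assume "x \<in> \<gamma> ` {act M w \<Phi> | w. set w \<subseteq> {..<rank M} - {i}}"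
    then show "x \<in> {act M w (\<gamma> \<Phi>) | w. set w \<subseteq> {..<rank M} - {i}}" using * by blast
  next
    fix x assume "x \<in> {act M w (\<gamma> \<Phi>) | w. set w \<subseteq> {..<rank M} - {i}}"
    then show "x \<in> \<gamma> ` {act M w \<Phi> | w. set w \<subseteq> {..<rank M} - {i}}"
      using *[symmetric] by blast
  qed
qed

lemma automorphism_id: "automorphism M id"
  by (simp add: automorphism_def permutes_id)

lemma automorphism_comp:
  "automorphism M \<gamma> \<Longrightarrow> automorphism M \<delta> \<Longrightarrow> automorphism M (\<gamma> \<circ> \<delta>)"
  using automorphism_in by (auto simp: automorphism_def permutes_compose)

lemma automorphism_eqI:
  assumes "automorphism M \<gamma>" "automorphism M \<delta>" "\<Phi> \<in> flags M" "\<gamma> \<Phi> = \<delta> \<Phi>"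
    and "\<Psi> \<in> flags M"
  shows "\<gamma> \<Psi> = \<delta> \<Psi>"
proof -
  obtain w where "set w \<subseteq> {..<rank M}" "\<Psi> = act M w \<Phi>"
    using connected assms by blast
  then show ?thesis
    using automorphism_act[OF assms(1,3), of w] automorphism_act[OF assms(2,3), of w] assms(4)
    by simp
qed

text \<open>Words that agree on one flag agree on all flags, because automorphisms commute with words
  and move any flag to any other.\<close>

lemma act_eq_everywhere:
  assumes "\<Phi> \<in> flags M" "set w \<subseteq> {..<rank M}" "set v \<subseteq> {..<rank M}"
    and "act M w \<Phi> = act M v \<Phi>" "\<Psi> \<in> flags M"
  shows "act M w \<Psi> = act M v \<Psi>"
proof -
  obtain \<gamma> where "automorphism M \<gamma>" "\<gamma> \<Phi> = \<Psi>" using flag_transitive assms by blast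
  then show ?thesis
    using automorphism_act[of \<gamma> \<Phi> w] automorphism_act[of \<gamma> \<Phi> v] assms by simp
qed

text \<open>A word changes the 2-colouring for \<open>P\<close> once for each of its letters in \<open>P\<close>.\<close>

lemma even_length_filter_eq:
  assumes "\<Phi> \<in> flags M" "set w \<subseteq> {..<rank M}" "set v \<subseteq> {..<rank M}"
    and "act M w \<Phi> = act M v \<Phi>"
  shows "even (length (filter P w)) = even (length (filter P v))"
proof -
  obtain f where f: "\<And>\<Phi> i. \<Phi> \<in> flags M \<Longrightarrow> i < rank M \<Longrightarrow> f (nbr M i \<Phi>) = (f \<Phi> \<noteq> P i)"
    using two_colouring[of P] by blast
  have "f (act M u \<Phi>) = (f \<Phi> \<noteq> odd (length (filter P u)))" if "set u \<subseteq> {..<rank M}" for u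
    using that
  proof (induction u)
    case (Cons i u)
    then have "act M u \<Phi> \<in> flags M" using act_in assms(1) by simp
    then show ?case using Cons f by auto
  qed simp
  from this[of w] this[of v] show ?thesis using assms by auto
qed

end

section \<open>The square\<close>

lemma flags_square:
  "flags square = {Sq 0 0, Sq 1 0, Sq 1 1, Sq 2 1, Sq 2 2, Sq 3 2, Sq 3 3, Sq 0 3}"
proof -
  have "flags square = (\<Union>e\<in>{..<4}. {Sq e e, Sq (Suc e mod 4) e})"
    unfolding square_def by auto
  also have "{..<4} = {0, 1, 2, 3 :: nat}" by auto
  finally show ?thesis by (simp add: insert_commute numeral_2_eq_2[symmetric])
qed

lemma rank_square: "rank square = 2"
  by (simp add: square_def)

lemma nbr_square:
  "nbr square i (Sq v e) =
     (if i = 0 then Sq (if v = e then Suc e mod 4 else e) e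
      else Sq v (if e = v then (v + 3) mod 4 else v))"
  by (simp add: square_def)

text \<open>The facts about the square are checked on its eight flags one by one. As \<open>Suc 1\<close> evaluates to
  \<open>Suc (Suc 0)\<close>, it has to be folded back into the numeral that occurs in the list of flags.\<close>

lemma nbr_square_in: "\<Phi> \<in> flags square \<Longrightarrow> nbr square i \<Phi> \<in> flags square"
  unfolding flags_square
  by (elim insertE emptyE; simp add: nbr_square numeral_2_eq_2[symmetric])

lemma nbr_square_nbr: "\<Phi> \<in> flags square \<Longrightarrow> nbr square i (nbr square i \<Phi>) = \<Phi>"
  unfolding flags_square
  by (elim insertE emptyE; simp add: nbr_square numeral_2_eq_2[symmetric])

text \<open>The symmetries of the square: the rotation by \<open>d\<close> and the reflection \<open>v \<mapsto> d - v\<close>.\<close>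

fun dihedral :: "bool \<Rightarrow> nat \<Rightarrow> flag \<Rightarrow> flag" where
  "dihedral True d (Sq v e) = Sq ((v + d) mod 4) ((e + d) mod 4)"
| "dihedral False d (Sq v e) = Sq ((d + 4 - v) mod 4) ((d + 3 - e) mod 4)"
| "dihedral s d (Ext \<Phi> x) = Ext \<Phi> x"

lemma dihedral_in:
  assumes "d \<in> {0, 1, 2, 3}" "\<Phi> \<in> flags square"
  shows "dihedral s d \<Phi> \<in> flags square"
  using assms unfolding flags_square
  by (cases s; elim insertE emptyE; simp add: numeral_2_eq_2[symmetric])

lemma dihedral_nbr:
  assumes "d \<in> {0, 1, 2, 3}" "\<Phi> \<in> flags square"
  shows "dihedral s d (nbr square i \<Phi>) = nbr square i (dihedral s d \<Phi>)"
  using assms unfolding flags_square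
  by (cases s; elim insertE emptyE; simp add: nbr_square numeral_2_eq_2[symmetric])

lemma dihedral_inverse:
  assumes "d \<in> {0, 1, 2, 3}" "\<Phi> \<in> flags square"
  shows "dihedral True d (dihedral True ((4 - d) mod 4) \<Phi>) = \<Phi>"
    and "dihedral True ((4 - d) mod 4) (dihedral True d \<Phi>) = \<Phi>"
    and "dihedral False d (dihedral False d \<Phi>) = \<Phi>"
  using assms unfolding flags_square
  by (elim insertE emptyE; simp add: numeral_2_eq_2[symmetric])+

lemma automorphism_dihedral:
  assumes "d \<in> {0, 1, 2, 3}"
  shows "automorphism square (\<lambda>\<Phi>. if \<Phi> \<in> flags square then dihedral s d \<Phi> else \<Phi>)"
    (is "automorphism square ?\<gamma>")
proof -
  obtain d' where d': "d' \<in> {0, 1, 2, 3}"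
    "\<And>\<Phi>. \<Phi> \<in> flags square \<Longrightarrow> dihedral s d (dihedral s d' \<Phi>) = \<Phi>"
    "\<And>\<Phi>. \<Phi> \<in> flags square \<Longrightarrow> dihedral s d' (dihedral s d \<Phi>) = \<Phi>"
  proof (cases s)
    case True
    moreover have "(4 - d) mod 4 \<in> {0, 1, 2, 3}" using assms by auto
    ultimately show ?thesis using that[of "(4 - d) mod 4"] dihedral_inverse[OF assms] by simp
  next
    case False
    then show ?thesis using that[of d] assms dihedral_inverse[OF assms] by simp
  qed
  have "bij_betw ?\<gamma> (flags square) (flags square)"
    by (rule bij_betw_byWitness[where f' = "dihedral s d'"])
      (use d' assms in \<open>auto simp: dihedral_in\<close>)
  then have "?\<gamma> permutes flags square" by (rule bij_imp_permutes) simp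
  then show ?thesis
    using dihedral_nbr[OF assms] by (simp add: automorphism_def nbr_square_in)
qed

lemma square_flag_transitive:
  assumes "\<Phi> \<in> flags square" "\<Psi> \<in> flags square"
  shows "\<exists>\<gamma>. automorphism square \<gamma> \<and> \<gamma> \<Phi> = \<Psi>"
proof -
  have "\<exists>s. \<exists>d\<in>{0, 1, 2, 3}. dihedral s d \<Phi> = \<Psi>"
    using assms unfolding flags_square ex_bool_eq
    by (elim insertE emptyE; simp add: numeral_2_eq_2[symmetric])
  then show ?thesis using automorphism_dihedral assms(1) by fastforce
qed

lemma square_regular: "regular_even_polytope square"
proof
  show "2 \<le> rank square" by (simp add: rank_square)
  show "finite (flags square)" "flags square \<noteq> {}" by (simp_all add: flags_square)
  fix \<Phi> :: flag and i :: nat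
  assume \<Phi>: "\<Phi> \<in> flags square"
  show "nbr square i \<Phi> \<in> flags square" "nbr square i (nbr square i \<Phi>) = \<Phi>"
    using \<Phi> by (simp_all add: nbr_square_in nbr_square_nbr)
  show "nbr square i (nbr square j \<Phi>) = nbr square j (nbr square i \<Phi>)"
    if "i + 2 \<le> j" "j < rank square" for j
    using that by (simp add: rank_square)
  show "nbr square 0 (nbr square 1 \<Phi>) \<noteq> nbr square 1 (nbr square 0 \<Phi>)"
    using \<Phi> unfolding flags_square
    by (elim insertE emptyE; simp add: nbr_square numeral_2_eq_2[symmetric])
  have act_closed: "act square w \<Phi> \<in> flags square" if "\<Phi> \<in> flags square" for w \<Phi>
    using that by (induction w) (auto simp: nbr_square_in)
  have act_inv: "act square (rev w) (act square w \<Phi>) = \<Phi>" if "\<Phi> \<in> flags square" for w \<Phi>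
    using that by (induction w) (auto simp: act_closed nbr_square_nbr)
  have reach: "\<exists>w. set w \<subseteq> {..<2} \<and> \<Theta> = act square w (Sq 0 0)" if "\<Theta> \<in> flags square" for \<Theta>
  proof -
    have "\<exists>w\<in>{[], [0], [1,0], [0,1,0], [1,0,1,0], [1], [0,1], [1,0,1]}. \<Theta> = act square w (Sq 0 0)"
      using that unfolding flags_square
      by (elim insertE emptyE; simp add: nbr_square numeral_2_eq_2[symmetric])
    then show ?thesis by (elim bexE) (rule exI, rule conjI, auto)
  qed
  show "\<exists>w. set w \<subseteq> {..<rank square} \<and> \<Psi> = act square w \<Phi>" if \<Psi>: "\<Psi> \<in> flags square" for \<Psi>
  proof -
    obtain w v where "set w \<subseteq> {..<2}" "\<Phi> = act square w (Sq 0 0)"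
      "set v \<subseteq> {..<2}" "\<Psi> = act square v (Sq 0 0)"
      using reach[OF \<Phi>] reach[OF \<Psi>] by auto
    moreover have "Sq 0 0 \<in> flags square" by (simp add: flags_square)
    ultimately have "set (v @ rev w) \<subseteq> {..<rank square}" "\<Psi> = act square (v @ rev w) \<Phi>"
      using act_inv by (simp_all add: rank_square)
    then show ?thesis by blast
  qed
  show "\<exists>\<gamma>. automorphism square \<gamma> \<and> \<gamma> \<Phi> = \<Psi>" if "\<Psi> \<in> flags square" for \<Psi>
    using square_flag_transitive \<Phi> that .
  show "\<exists>u. set u \<subseteq> {k..m} \<and> set u \<subseteq> {..<rank square} \<and> act square u \<Phi> = act square w \<Phi>"
    if w: "set w \<subseteq> {..<rank square}" "set w \<subseteq> {..m}" and v: "set v \<subseteq> {k..<rank square}"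
      and eq: "act square w \<Phi> = act square v \<Phi>" for w v k m
  proof -
    consider "k = 0" | "1 \<le> m" | "m = 0" "1 \<le> k" by linarith
    then show ?thesis
    proof cases
      case 1
      then show ?thesis using w by (intro exI[of _ w]) auto
    next
      case 2
      then have "set v \<subseteq> {k..m}" using v by (force simp: rank_square)
      then show ?thesis using v eq by (intro exI[of _ v]) auto
    next
      case 3
      obtain p q where pq: "\<Phi> = Sq p q" using \<Phi> by (auto simp: flags_square)
      \<comment> \<open>Words in colour 0 fix the edge, words in colour 1 the vertex.\<close>
      have "set w \<subseteq> {0} \<Longrightarrow> \<exists>p'. act square w (Sq p q) = Sq p' q"
        by (induction w) (auto simp: nbr_square numeral_2_eq_2[symmetric])
      moreover have "set v \<subseteq> {1} \<Longrightarrow> \<exists>q'. act square v (Sq p q) = Sq p q'"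
        by (induction v) (auto simp: nbr_square numeral_2_eq_2[symmetric])
      moreover have "set w \<subseteq> {0}" using w(2) 3 by auto
      moreover have "set v \<subseteq> {1}" using v 3 by (force simp: rank_square)
      ultimately have "act square w \<Phi> = \<Phi>" using eq pq by fastforce
      then show ?thesis by (intro exI[of _ "[]"]) simp
    qed
  qed
next
  fix P :: "nat \<Rightarrow> bool"
  \<comment> \<open>Colour 0 changes the parity of the vertex only, colour 1 that of the edge only.\<close>
  let ?f = "\<lambda>\<Phi>. case \<Phi> of Sq v e \<Rightarrow> ((P 0 \<and> odd v) \<noteq> (P 1 \<and> odd e)) | Ext \<Phi> x \<Rightarrow> False"
  have "\<forall>\<Phi>\<in>flags square. \<forall>i<2. ?f (nbr square i \<Phi>) = (?f \<Phi> \<noteq> P i)"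
    unfolding flags_square numeral_2_eq_2 less_Suc_eq
    by (auto simp: nbr_square numeral_2_eq_2[symmetric])
  then show "\<exists>f. \<forall>\<Phi>\<in>flags square. \<forall>i<rank square. f (nbr square i \<Phi>) = (f \<Phi> \<noteq> P i)"
    unfolding rank_square by blast
qed

section \<open>The extension \<open>hat2\<close> of a regular polytope\<close>

\<comment> \<open>Facets are faces of rank \<open>rank M - 1\<close>; this expression should not be rewritten.\<close>
declare One_nat_def [simp del]

lemma rank_hat2 [simp]: "rank (hat2 M) = Suc (rank M)"
  by (simp add: hat2_def)

lemma flags_hat2 [simp]:
  "Ext \<Phi> x \<in> flags (hat2 M) \<longleftrightarrow> \<Phi> \<in> flags M \<and> supp x \<subseteq> facets M"
  by (auto simp: hat2_def)

lemma flag_hat2E: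
  assumes "\<Psi> \<in> flags (hat2 M)"
  obtains \<Phi> x where "\<Psi> = Ext \<Phi> x" "\<Phi> \<in> flags M" "supp x \<subseteq> facets M"
  using assms by (auto simp: hat2_def)

lemma nbr_hat2_low [simp]: "i < rank M \<Longrightarrow> nbr (hat2 M) i (Ext \<Phi> x) = Ext (nbr M i \<Phi>) x"
  by (simp add: hat2_def)

lemma nbr_hat2_high:
  "\<not> i < rank M \<Longrightarrow> nbr (hat2 M) i (Ext \<Phi> x) = Ext \<Phi> (vplus x (chi (facet_of M \<Phi>)))"
  by (simp add: hat2_def)

lemma act_hat2_low:
  "set w \<subseteq> {..<rank M} \<Longrightarrow> act (hat2 M) w (Ext \<Phi> x) = Ext (act M w \<Phi>) x"
  by (induction w) auto

text \<open>The first component of a flag only sees the letters below the rank of \<open>M\<close>.\<close>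

lemma act_hat2_fst:
  "\<exists>z. act (hat2 M) w (Ext \<Phi> x) = Ext (act M (filter (\<lambda>i. i < rank M) w) \<Phi>) z"
  by (induction w) (auto simp: nbr_hat2_high)

lemma inj_fset: "inj fset"
  by (simp add: fset_inject inj_def)

lemma inj_supp: "inj supp"
  unfolding supp_def by (simp add: inj_def inj_image_eq_iff inj_fset fset_inject)

lemma supp_eq_iff: "supp x = supp y \<longleftrightarrow> x = y"
  using inj_supp by (auto dest: injD)

lemma supp_vplus: "supp (vplus x y) = (supp x - supp y) \<union> (supp y - supp x)"
  by (simp only: inj_fset supp_def vplus_def union_fset minus_fset image_Un image_set_diff)

lemma supp_chi: "finite F \<Longrightarrow> supp (chi F) = {F}"
  by (simp add: supp_def chi_def Abs_fset_inverse)

lemma supp_vzero [simp]: "supp vzero = {}"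
  by (simp add: supp_def vzero_def)

lemma vplus_self_cancel [simp]: "vplus (vplus x y) y = x"
  unfolding supp_eq_iff[symmetric] supp_vplus by blast

lemma vplus_cancel_left [simp]: "vplus x (vplus x y) = y"
  unfolding supp_eq_iff[symmetric] supp_vplus by blast

lemma vplus_assoc: "vplus (vplus x y) z = vplus x (vplus y z)"
  unfolding supp_eq_iff[symmetric] supp_vplus by blast

lemma vplus_right_commute: "vplus (vplus x y) z = vplus (vplus x z) y"
  unfolding supp_eq_iff[symmetric] supp_vplus by blast

text \<open>Hence the parity of the support records the number of steps of the highest colour.\<close>

lemma even_fcard_vplus_chi: "even (fcard (vplus x (chi F))) \<longleftrightarrow> odd (fcard x)"
proof (cases "Abs_fset F |\<in>| x")
  case True
  then have "vplus x (chi F) = x |-| {|Abs_fset F|}" by (auto simp: vplus_def chi_def)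
  moreover have "fcard x = Suc (fcard (x |-| {|Abs_fset F|}))"
    using True by (metis fcard_Suc_fminus1)
  ultimately show ?thesis by simp
next
  case False
  then have "vplus x (chi F) = finsert (Abs_fset F) x" by (auto simp: vplus_def chi_def)
  then show ?thesis using False by (simp add: fcard_finsert_disjoint)
qed

definition vec_act :: "(flag \<Rightarrow> flag) \<Rightarrow> vec \<Rightarrow> vec" where
  "vec_act \<gamma> x = fimage (fimage \<gamma>) x"

lemma supp_vec_act: "supp (vec_act \<gamma> x) = facet_act \<gamma> (supp x)"
  by (auto simp: supp_def vec_act_def facet_act_def image_image)

lemma inj_image: "inj \<gamma> \<Longrightarrow> inj ((`) \<gamma>)"
  by (simp add: inj_def inj_image_eq_iff)

lemma vec_act_vplus:
  assumes "inj \<gamma>"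
  shows "vec_act \<gamma> (vplus x y) = vplus (vec_act \<gamma> x) (vec_act \<gamma> y)"
  unfolding supp_eq_iff[symmetric]
  by (simp add: supp_vplus supp_vec_act facet_act_def image_Un image_set_diff inj_image[OF assms])

lemma vec_act_inject:
  assumes "inj \<gamma>" "vec_act \<gamma> x = vec_act \<gamma> y"
  shows "x = y"
proof -
  have "(`) \<gamma> ` supp x = (`) \<gamma> ` supp y"
    using assms(2) supp_vec_act[of \<gamma>] unfolding facet_act_def by metis
  then show ?thesis using inj_image[OF assms(1)] by (simp add: inj_image_eq_iff supp_eq_iff)
qed

lemma vec_act_chi:
  assumes "finite F"
  shows "vec_act \<gamma> (chi F) = chi (\<gamma> ` F)"
  unfolding supp_eq_iff[symmetric] supp_vec_act using assms by (simp add: supp_chi facet_act_def)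

locale hat2_extension = regular_even_polytope N for N :: "flag maniplex"
begin

lemma facet_of_in: "\<Phi> \<in> flags N \<Longrightarrow> facet_of N \<Phi> \<in> facets N"
  by (simp add: faces_def)

lemma supp_chi_facet: "\<Phi> \<in> flags N \<Longrightarrow> supp (chi (facet_of N \<Phi>)) = {facet_of N \<Phi>}"
  by (simp add: supp_chi finite_face)

lemma nbr_hat2_in:
  assumes "\<Phi> \<in> flags (hat2 N)" "i < rank (hat2 N)"
  shows "nbr (hat2 N) i \<Phi> \<in> flags (hat2 N)"
  using assms(1)
proof (rule flag_hat2E)
  fix \<Psi> x
  assume "\<Phi> = Ext \<Psi> x" "\<Psi> \<in> flags N" "supp x \<subseteq> facets N"
  then show ?thesis
    by (cases "i < rank N") (auto simp: nbr_in nbr_hat2_high supp_vplus supp_chi_facet facet_of_in)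
qed

lemma finite_flags_hat2: "finite (flags (hat2 N))"
proof -
  have "finite (supp -` Pow (facets N))"
    by (rule finite_vimageI) (auto simp: inj_supp faces_def finite_flags)
  moreover have "flags (hat2 N) \<subseteq> (\<lambda>(\<Phi>, x). Ext \<Phi> x) ` (flags N \<times> (supp -` Pow (facets N)))"
    by (auto elim!: flag_hat2E)
  ultimately show ?thesis using finite_flags finite_subset by blast
qed

text \<open>To add \<open>d\<close> to the vector of a flag, visit the facets in \<open>supp d\<close> one after the other and
  take a step of the highest colour in each of them.\<close>

lemma hat2_reach:
  assumes "\<Phi> \<in> flags N" "\<Psi> \<in> flags N" "supp d \<subseteq> facets N"
  shows "\<exists>w. set w \<subseteq> {..rank N} \<and> act (hat2 N) w (Ext \<Phi> x) = Ext \<Psi> (vplus x d)"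
  using assms(2,3)
proof (induction d arbitrary: \<Psi>)
  case empty
  obtain w where "set w \<subseteq> {..<rank N}" "\<Psi> = act N w \<Phi>" using connected assms(1) empty by blast
  moreover have "vplus x {||} = x" by (simp add: vplus_def)
  ultimately show ?case by (intro exI[of _ w]) (auto simp: act_hat2_low)
next
  case (insert a d)
  have "fset a \<in> facets N" "supp d \<subseteq> facets N" using insert.prems by (auto simp: supp_def)
  then obtain \<Theta> where \<Theta>: "\<Theta> \<in> flags N" "facet_of N \<Theta> = fset a" by (auto simp: faces_def)
  obtain w where w: "set w \<subseteq> {..rank N}" "act (hat2 N) w (Ext \<Phi> x) = Ext \<Theta> (vplus x d)"
    using insert.IH[OF \<Theta>(1) \<open>supp d \<subseteq> facets N\<close>] by blast
  obtain u where u: "set u \<subseteq> {..<rank N}" "\<Psi> = act N u \<Theta>"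
    using connected \<Theta>(1) insert.prems(1) by blast
  have chi: "chi (fset a) = {|a|}" by (simp add: chi_def fset_inverse)
  have "vplus d {|a|} = finsert a d" using insert.hyps by (auto simp: vplus_def)
  then have "vplus (vplus x d) {|a|} = vplus x (finsert a d)" by (simp add: vplus_assoc)
  then have "act (hat2 N) (u @ rank N # w) (Ext \<Phi> x) = Ext \<Psi> (vplus x (finsert a d))"
    using w u \<Theta> chi by (simp add: nbr_hat2_high act_hat2_low)
  moreover have "set (u @ rank N # w) \<subseteq> {..rank N}" using w u by auto
  ultimately show ?case by blast
qed

text \<open>An automorphism of \<open>N\<close>, acting on flags and on vectors, followed by the translation by \<open>t\<close> is
  an automorphism of \<open>hat2 N\<close>; together these move any flag to any other.\<close>

definition lift_automorphism :: "(flag \<Rightarrow> flag) \<Rightarrow> vec \<Rightarrow> flag \<Rightarrow> flag" where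
  "lift_automorphism \<gamma> t \<Phi> = (if \<Phi> \<in> flags (hat2 N)
     then (case \<Phi> of Sq v e \<Rightarrow> Sq v e | Ext \<Psi> x \<Rightarrow> Ext (\<gamma> \<Psi>) (vplus (vec_act \<gamma> x) t))
     else \<Phi>)"

lemma lift_automorphism_Ext:
  "\<Psi> \<in> flags N \<Longrightarrow> supp x \<subseteq> facets N
     \<Longrightarrow> lift_automorphism \<gamma> t (Ext \<Psi> x) = Ext (\<gamma> \<Psi>) (vplus (vec_act \<gamma> x) t)"
  by (simp add: lift_automorphism_def)

lemma facet_act_facets:
  assumes "automorphism N \<gamma>" "S \<subseteq> facets N"
  shows "facet_act \<gamma> S \<subseteq> facets N"
  using assms by (fastforce simp: facet_act_def faces_def automorphism_image_face automorphism_in)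

lemma automorphism_lift:
  assumes "automorphism N \<gamma>" and t: "supp t \<subseteq> facets N"
  shows "automorphism (hat2 N) (lift_automorphism \<gamma> t)"
proof -
  have inj: "inj \<gamma>" using assms(1) permutes_inj by (auto simp: automorphism_def)
  have Ext_in: "Ext (\<gamma> \<Psi>) (vplus (vec_act \<gamma> x) t) \<in> flags (hat2 N)"
    if "\<Psi> \<in> flags N" "supp x \<subseteq> facets N" for \<Psi> x
    using that t facet_act_facets[OF assms(1) that(2)] automorphism_in[OF assms(1) that(1)]
    by (auto simp: supp_vplus supp_vec_act)
  have "lift_automorphism \<gamma> t ` flags (hat2 N) \<subseteq> flags (hat2 N)"
    using Ext_in by (auto simp: lift_automorphism_Ext elim!: flag_hat2E simp del: flags_hat2)
  moreover have "inj_on (lift_automorphism \<gamma> t) (flags (hat2 N))"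
  proof (rule inj_onI)
    fix \<Phi> \<Psi>
    assume "\<Phi> \<in> flags (hat2 N)" "\<Psi> \<in> flags (hat2 N)"
      and eq: "lift_automorphism \<gamma> t \<Phi> = lift_automorphism \<gamma> t \<Psi>"
    then obtain \<Phi>' x \<Psi>' y where "\<Phi> = Ext \<Phi>' x" "\<Phi>' \<in> flags N" "supp x \<subseteq> facets N"
      "\<Psi> = Ext \<Psi>' y" "\<Psi>' \<in> flags N" "supp y \<subseteq> facets N" by (auto elim!: flag_hat2E)
    moreover from this eq have "\<gamma> \<Phi>' = \<gamma> \<Psi>'"
      "vplus (vec_act \<gamma> x) t = vplus (vec_act \<gamma> y) t" by (simp_all add: lift_automorphism_Ext)
    moreover from this have "vec_act \<gamma> x = vec_act \<gamma> y" by (metis vplus_self_cancel)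
    ultimately show "\<Phi> = \<Psi>" using inj vec_act_inject by (auto dest: injD)
  qed
  ultimately have "bij_betw (lift_automorphism \<gamma> t) (flags (hat2 N)) (flags (hat2 N))"
    unfolding bij_betw_def using endo_inj_surj finite_flags_hat2 by blast
  then have "lift_automorphism \<gamma> t permutes flags (hat2 N)"
    by (rule bij_imp_permutes) (simp add: lift_automorphism_def)
  moreover have "lift_automorphism \<gamma> t (nbr (hat2 N) i \<Phi>) = nbr (hat2 N) i (lift_automorphism \<gamma> t \<Phi>)"
    if \<Phi>: "\<Phi> \<in> flags (hat2 N)" and i: "i < rank (hat2 N)" for \<Phi> i
  proof -
    obtain \<Psi> x where \<Psi>: "\<Phi> = Ext \<Psi> x" "\<Psi> \<in> flags N" "supp x \<subseteq> facets N"
      using \<Phi> by (rule flag_hat2E)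
    show ?thesis
    proof (cases "i < rank N")
      case True
      then show ?thesis
        using \<Psi> nbr_in assms(1) by (simp add: lift_automorphism_Ext automorphism_def)
    next
      case False
      have "supp (vplus x (chi (facet_of N \<Psi>))) \<subseteq> facets N"
        using \<Psi> by (auto simp: supp_vplus supp_chi_facet facet_of_in)
      moreover have "vec_act \<gamma> (chi (facet_of N \<Psi>)) = chi (facet_of N (\<gamma> \<Psi>))"
        using \<Psi> by (simp add: vec_act_chi finite_face automorphism_image_face[OF assms(1)])
      ultimately show ?thesis using \<Psi> False
        by (simp add: nbr_hat2_high lift_automorphism_Ext vec_act_vplus[OF inj] vplus_right_commute)
    qed
  qed
  ultimately show ?thesis by (simp add: automorphism_def)
qed

lemma hat2_regular: "regular_even_polytope (hat2 N)"
proof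
  show "2 \<le> rank (hat2 N)" using rank_ge_2 by simp
  show "finite (flags (hat2 N))" by (rule finite_flags_hat2)
  obtain \<Phi>\<^sub>0 where "\<Phi>\<^sub>0 \<in> flags N" using flags_nonempty by blast
  then have "Ext \<Phi>\<^sub>0 vzero \<in> flags (hat2 N)" by simp
  then show "flags (hat2 N) \<noteq> {}" by blast
  fix \<Phi> i
  assume "\<Phi> \<in> flags (hat2 N)"
  then obtain \<Phi>' x where \<Phi>: "\<Phi> = Ext \<Phi>' x" "\<Phi>' \<in> flags N" "supp x \<subseteq> facets N"
    by (rule flag_hat2E)
  show "nbr (hat2 N) i \<Phi> \<in> flags (hat2 N)" if "i < rank (hat2 N)"
    using \<open>\<Phi> \<in> flags (hat2 N)\<close> that by (rule nbr_hat2_in)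
  show "nbr (hat2 N) i (nbr (hat2 N) i \<Phi>) = \<Phi>" if "i < rank (hat2 N)"
    using \<Phi> by (cases "i < rank N") (simp_all add: nbr_nbr nbr_hat2_high)
  show "nbr (hat2 N) i (nbr (hat2 N) j \<Phi>) = nbr (hat2 N) j (nbr (hat2 N) i \<Phi>)"
    if "i + 2 \<le> j" "j < rank (hat2 N)" for j
    using that \<Phi> nbr_commute[of \<Phi>' i j] face_nbr[of \<Phi>' i "rank N - 1"]
    by (cases "j < rank N") (simp_all add: nbr_hat2_high)
  show "nbr (hat2 N) 0 (nbr (hat2 N) 1 \<Phi>) \<noteq> nbr (hat2 N) 1 (nbr (hat2 N) 0 \<Phi>)"
    using \<Phi> rank_ge_2 nbr_0_1_not_commute by simp
  show "\<exists>w. set w \<subseteq> {..<rank (hat2 N)} \<and> \<Psi> = act (hat2 N) w \<Phi>"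
    if \<Psi>: "\<Psi> \<in> flags (hat2 N)" for \<Psi>
  proof -
    obtain \<Psi>' y where "\<Psi> = Ext \<Psi>' y" "\<Psi>' \<in> flags N" "supp y \<subseteq> facets N"
      using \<Psi> by (rule flag_hat2E)
    moreover from this \<Phi> have "supp (vplus x y) \<subseteq> facets N" by (auto simp: supp_vplus)
    ultimately obtain w where "set w \<subseteq> {..rank N}" "act (hat2 N) w \<Phi> = \<Psi>"
      using hat2_reach[of \<Phi>' \<Psi>' "vplus x y" x] \<Phi> by auto
    then show ?thesis by (auto simp: lessThan_Suc_atMost)
  qed
  show "\<exists>\<gamma>. automorphism (hat2 N) \<gamma> \<and> \<gamma> \<Phi> = \<Psi>" if \<Psi>: "\<Psi> \<in> flags (hat2 N)" for \<Psi>
  proof -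
    obtain \<Psi>' y where \<Psi>': "\<Psi> = Ext \<Psi>' y" "\<Psi>' \<in> flags N" "supp y \<subseteq> facets N"
      using \<Psi> by (rule flag_hat2E)
    obtain \<gamma> where \<gamma>: "automorphism N \<gamma>" "\<gamma> \<Phi>' = \<Psi>'" using flag_transitive \<Phi> \<Psi>' by blast
    let ?t = "vplus (vec_act \<gamma> x) y"
    have "supp ?t \<subseteq> facets N"
      using facet_act_facets[OF \<gamma>(1) \<Phi>(3)] \<Psi>' by (auto simp: supp_vplus supp_vec_act)
    then have "automorphism (hat2 N) (lift_automorphism \<gamma> ?t)" by (rule automorphism_lift[OF \<gamma>(1)])
    moreover have "lift_automorphism \<gamma> ?t \<Phi> = \<Psi>"
      using \<Phi> \<Psi>' \<gamma> by (simp add: lift_automorphism_Ext)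
    ultimately show ?thesis by blast
  qed
  show "\<exists>u. set u \<subseteq> {k..m} \<and> set u \<subseteq> {..<rank (hat2 N)} \<and> act (hat2 N) u \<Phi> = act (hat2 N) w \<Phi>"
    if w: "set w \<subseteq> {..<rank (hat2 N)}" "set w \<subseteq> {..m}" and v: "set v \<subseteq> {k..<rank (hat2 N)}"
      and eq: "act (hat2 N) w \<Phi> = act (hat2 N) v \<Phi>" for w v k m
  proof (cases "rank N \<le> m")
    case True
    then show ?thesis using v eq by (intro exI[of _ v]) force
  next
    case False
    \<comment> \<open>Now \<open>w\<close> does not change the vector, so only the flags of \<open>N\<close> matter.\<close>
    then have w': "set w \<subseteq> {..<rank N}" using w(2) by force
    let ?v = "filter (\<lambda>i. i < rank N) v"
    have "act N w \<Phi>' = act N ?v \<Phi>'"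
      using eq act_hat2_fst[of N v \<Phi>' x] w' \<Phi>(1) by (auto simp: act_hat2_low)
    moreover have "set ?v \<subseteq> {k..<rank N}" using v by auto
    ultimately obtain u where u: "set u \<subseteq> {k..m}" "set u \<subseteq> {..<rank N}" "act N u \<Phi>' = act N w \<Phi>'"
      using meet_property[OF \<Phi>(2) w' w(2)] by blast
    then have "act (hat2 N) u \<Phi> = act (hat2 N) w \<Phi>"
      using \<Phi>(1) w' by (simp add: act_hat2_low)
    then show ?thesis using u by (intro exI[of _ u]) auto
  qed
next
  fix P :: "nat \<Rightarrow> bool"
  obtain f where f: "\<And>\<Phi> i. \<Phi> \<in> flags N \<Longrightarrow> i < rank N \<Longrightarrow> f (nbr N i \<Phi>) = (f \<Phi> \<noteq> P i)"
    using two_colouring[of P] by blast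
  \<comment> \<open>If the new colour is in \<open>P\<close>, the parity of the support enters the 2-colouring.\<close>
  let ?f = "\<lambda>\<Phi>. case \<Phi> of Sq v e \<Rightarrow> False | Ext \<Psi> x \<Rightarrow> (f \<Psi> \<noteq> (P (rank N) \<and> odd (fcard x)))"
  have "?f (nbr (hat2 N) i \<Phi>) = (?f \<Phi> \<noteq> P i)"
    if "\<Phi> \<in> flags (hat2 N)" "i < rank (hat2 N)" for \<Phi> i
    using that(1)
  proof (rule flag_hat2E)
    fix \<Psi> x
    assume "\<Phi> = Ext \<Psi> x" "\<Psi> \<in> flags N" "supp x \<subseteq> facets N"
    moreover have "i < rank N \<or> i = rank N" using that(2) by auto
    ultimately show ?thesis by (auto simp: f nbr_hat2_high even_fcard_vplus_chi)
  qed
  then show "\<exists>f. \<forall>\<Phi>\<in>flags (hat2 N). \<forall>i<rank (hat2 N). f (nbr (hat2 N) i \<Phi>) = (f \<Phi> \<noteq> P i)"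
    by blast
qed

end

lemma Mfam_Suc: "2 \<le> n \<Longrightarrow> \<M> (Suc n) = hat2 (\<M> n)"
  by (auto simp: Mfam_def dest!: le_Suc_ex)

lemma rank_Mfam: "2 \<le> n \<Longrightarrow> rank (\<M> n) = n"
  by (induction n rule: dec_induct) (simp_all add: Mfam_Suc, simp add: Mfam_def rank_square)

lemma Mfam_regular: "2 \<le> n \<Longrightarrow> regular_even_polytope (\<M> n)"
proof (induction n rule: dec_induct)
  case base
  show ?case using square_regular by (simp add: Mfam_def)
next
  case (step n)
  then show ?case using hat2_extension.hat2_regular hat2_extension.intro by (simp add: Mfam_Suc)
qed

section \<open>The sets $S_j$ are not covered by two vertices\<close>

definition uncovered :: "'f maniplex \<Rightarrow> 'f set set \<Rightarrow> bool" where
  "uncovered M S \<longleftrightarrow>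
     (\<forall>u\<in>faces M 0. \<forall>v\<in>faces M 0. \<exists>F\<in>S. \<not> incident F u \<and> \<not> incident F v)"

context hat2_extension
begin

interpretation H: regular_even_polytope "hat2 N"
  by (rule hat2_regular)

text \<open>A path that keeps the vertex changes the vector only by facets at this vertex.\<close>

lemma vertex_hat2:
  assumes \<Phi>: "\<Phi> \<in> flags N" "supp x \<subseteq> facets N"
    and \<Psi>: "Ext \<Psi> y \<in> face (hat2 N) 0 (Ext \<Phi> x)"
  shows "supp (vplus x y) \<subseteq> {G. incident G (face N 0 \<Phi>)}"
proof -
  obtain w where w: "set w \<subseteq> {..<rank (hat2 N)} - {0}" "Ext \<Psi> y = act (hat2 N) w (Ext \<Phi> x)"
    using \<Psi> \<Phi> by (auto simp: H.face_eq)
  then have "\<Psi> \<in> face N 0 \<Phi> \<and> supp (vplus x y) \<subseteq> {G. incident G (face N 0 \<Phi>)}"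
  proof (induction w arbitrary: \<Psi> y)
    case Nil
    then have "\<Psi> = \<Phi>" "vplus x y = vzero"
      by (simp_all flip: supp_eq_iff add: supp_vplus)
    then show ?case by (simp add: face_refl)
  next
    case (Cons i w)
    obtain \<Psi>' y' where \<Psi>': "act (hat2 N) w (Ext \<Phi> x) = Ext \<Psi>' y'"
      using act_hat2_fst by blast
    then have IH: "\<Psi>' \<in> face N 0 \<Phi>" "supp (vplus x y') \<subseteq> {G. incident G (face N 0 \<Phi>)}"
      using Cons by auto
    then have flag: "\<Psi>' \<in> flags N" and face: "face N 0 \<Psi>' = face N 0 \<Phi>"
      using face_subset_flags face_of_mem \<Phi>(1) by blast+
    show ?case
    proof (cases "i < rank N")
      case True
      moreover have "i \<noteq> 0" using Cons.prems(1) by simp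
      ultimately have "face N 0 (nbr N i \<Psi>') = face N 0 \<Phi>"
        using face_nbr[OF flag] face by simp
      then show ?thesis using IH Cons.prems(2) \<Psi>' True face_refl[of "nbr N i \<Psi>'" 0] by simp
    next
      case False
      have "incident (facet_of N \<Psi>') (face N 0 \<Phi>)"
        using incident_faces_of_flag[of "rank N - 1" \<Psi>' 0] face by simp
      then show ?thesis
        using IH Cons.prems(2) \<Psi>' False flag
        by (auto simp: nbr_hat2_high supp_vplus supp_chi_facet)
    qed
  qed
  then show ?thesis by simp
qed

lemma face_hat2_top:
  assumes "\<Phi> \<in> flags N" "supp x \<subseteq> facets N"
  shows "face (hat2 N) (rank N) (Ext \<Phi> x) = hat_facet N x"
proof -
  have "{..<rank (hat2 N)} - {rank N} = {..<rank N}" by auto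
  then have "face (hat2 N) (rank N) (Ext \<Phi> x) =
      {act (hat2 N) w (Ext \<Phi> x) | w. set w \<subseteq> {..<rank N}}"
    using assms by (simp add: H.face_eq)
  also have "\<dots> = {Ext (act N w \<Phi>) x | w. set w \<subseteq> {..<rank N}}"
    by (metis (no_types, lifting) act_hat2_low)
  also have "\<dots> = hat_facet N x"
    using connected[OF assms(1)] act_in[OF assms(1)] by (auto simp: hat_facet_def)
  finally show ?thesis .
qed

lemma facets_hat2: "facets (hat2 N) = hat_facet N ` {x. supp x \<subseteq> facets N}"
proof -
  obtain \<Phi> where \<Phi>: "\<Phi> \<in> flags N" using flags_nonempty by blast
  have "hat_facet N x \<in> faces (hat2 N) (rank N)" if "supp x \<subseteq> facets N" for x
    unfolding faces_def
    by (rule image_eqI[of _ _ "Ext \<Phi> x"]) (use \<Phi> that in \<open>simp_all add: face_hat2_top\<close>)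
  then show ?thesis by (auto simp: faces_def face_hat2_top elim!: flag_hat2E)
qed

lemma incident_hat_facet_vertex:
  assumes "\<Phi> \<in> flags N" "supp x \<subseteq> facets N"
    and "incident (hat_facet N y) (face (hat2 N) 0 (Ext \<Phi> x))"
  shows "supp (vplus x y) \<subseteq> {G. incident G (face N 0 \<Phi>)}"
  using vertex_hat2[OF assms(1,2)] assms(3) by (auto simp: incident_def hat_facet_def)

text \<open>If two vertices of \<open>hat2 N\<close> cover the new set, then one of them, over \<open>v\<close> say, is in the facet
  with vector 0, so its vector is supported on facets at \<open>v\<close>, and it misses the facets with vector
  \<open>chi F\<close> for the \<open>F\<close> in \<open>S\<close> away from \<open>v\<close>. The other vertex, over \<open>u\<close>, has to be in all of these.
  There are at least two such \<open>F\<close>, one of them also away from \<open>u\<close>, and \<open>u\<close> is then not compatible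
  with both.\<close>

lemma uncovered_hat2:
  assumes S: "S \<subseteq> facets N" and unc: "uncovered N S"
  shows "uncovered (hat2 N) ((\<lambda>F. hat_facet N (chi F)) ` S \<union> {hat_facet N vzero})"
    (is "uncovered _ ?S")
proof -
  let ?A = "\<lambda>\<Phi>. {G. incident G (face N 0 \<Phi>)}"
  let ?vtx = "\<lambda>\<Phi> x. face (hat2 N) 0 (Ext \<Phi> x)"
  have *: False
    if \<Phi>: "\<Phi> \<in> flags N" "supp x \<subseteq> facets N" and \<Psi>: "\<Psi> \<in> flags N" "supp y \<subseteq> facets N"
      and cov: "\<And>G. G \<in> ?S \<Longrightarrow> incident G (?vtx \<Phi> x) \<or> incident G (?vtx \<Psi> y)"
      and zero: "incident (hat_facet N vzero) (?vtx \<Psi> y)" for \<Phi> x \<Psi> y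
  proof -
    have y: "supp y \<subseteq> ?A \<Psi>"
      using incident_hat_facet_vertex[OF \<Psi> zero] by (simp add: supp_vplus)
    \<comment> \<open>The facets of \<open>S\<close> away from the second vertex must all be at the first one.\<close>
    have x: "supp (vplus x (chi G)) \<subseteq> ?A \<Phi>" if G: "G \<in> S" "G \<notin> ?A \<Psi>" for G
    proof -
      have "supp (chi G) = {G}" using G(1) S finite_faces supp_chi by blast
      then have "\<not> supp (vplus y (chi G)) \<subseteq> ?A \<Psi>" using y G(2) by (auto simp: supp_vplus)
      then have "\<not> incident (hat_facet N (chi G)) (?vtx \<Psi> y)"
        using incident_hat_facet_vertex[OF \<Psi>] by blast
      then have "incident (hat_facet N (chi G)) (?vtx \<Phi> x)" using cov G(1) by blast
      then show ?thesis using incident_hat_facet_vertex[OF \<Phi>] by blast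
    qed
    have "face N 0 \<Phi> \<in> faces N 0" "face N 0 \<Psi> \<in> faces N 0"
      using \<Phi> \<Psi> by (auto simp: faces_def)
    then obtain F where F: "F \<in> S" "F \<notin> ?A \<Phi>" "F \<notin> ?A \<Psi>"
      using unc unfolding uncovered_def by blast
    \<comment> \<open>A vertex of \<open>F\<close> in place of the first vertex gives another facet away from the second.\<close>
    obtain \<Theta> where \<Theta>: "\<Theta> \<in> flags N" "F = facet_of N \<Theta>"
      using F(1) S by (auto simp: faces_def)
    then have "face N 0 \<Theta> \<in> faces N 0" by (auto simp: faces_def)
    then obtain F' where F': "F' \<in> S" "F' \<notin> ?A \<Theta>" "F' \<notin> ?A \<Psi>"
      using unc \<open>face N 0 \<Psi> \<in> faces N 0\<close> unfolding uncovered_def by blast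
    have "F \<in> ?A \<Theta>" using incident_faces_of_flag \<Theta>(2) by simp
    then have "F \<noteq> F'" using F' by blast
    moreover have "supp (chi F) = {F}" "supp (chi F') = {F'}"
      using F(1) F'(1) S finite_faces supp_chi by blast+
    ultimately show False
      using x[OF F(1,3)] x[OF F'(1,3)] F(2) unfolding supp_vplus by blast
  qed
  show ?thesis unfolding uncovered_def
  proof (intro ballI)
    fix u v
    assume "u \<in> faces (hat2 N) 0" "v \<in> faces (hat2 N) 0"
    then obtain \<Phi> x \<Psi> y where \<Phi>: "\<Phi> \<in> flags N" "supp x \<subseteq> facets N" "u = ?vtx \<Phi> x"
      and \<Psi>: "\<Psi> \<in> flags N" "supp y \<subseteq> facets N" "v = ?vtx \<Psi> y"
      by (auto simp: faces_def elim!: flag_hat2E)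
    show "\<exists>F\<in>?S. \<not> incident F u \<and> \<not> incident F v"
    proof (rule ccontr)
      assume "\<not> ?thesis"
      then have cov: "incident G u \<or> incident G v" if "G \<in> ?S" for G using that by blast
      have "incident (hat_facet N vzero) u \<or> incident (hat_facet N vzero) v"
        by (rule cov) simp
      then show False
        using *[OF \<Phi>(1,2) \<Psi>(1,2)] *[OF \<Psi>(1,2) \<Phi>(1,2)] cov \<Phi>(3) \<Psi>(3) by blast
    qed
  qed
qed

end

lemma Sfam_uncovered:
  assumes "admissible_S3 S3" "3 \<le> j"
  shows "Sfam S3 j \<subseteq> facets (\<M> j) \<and> uncovered (\<M> j) (Sfam S3 j)"
  using assms(2)
proof (induction j rule: dec_induct)
  case base
  have "\<exists>F\<in>S3. \<not> incident F u \<and> \<not> incident F v"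
    if "u \<in> faces (\<M> 3) 0" "v \<in> faces (\<M> 3) 0" for u v
  proof -
    have "S3 \<subseteq> facets (\<M> 3)"
      and "\<not> S3 \<subseteq> {F \<in> facets (\<M> 3). incident F u} \<union> {F \<in> facets (\<M> 3). incident F v}"
      using assms(1) that unfolding admissible_S3_def by blast+
    then show ?thesis by blast
  qed
  then show ?case using assms(1) by (simp add: Sfam.simps uncovered_def admissible_S3_def)
next
  case (step j)
  interpret hat2_extension "\<M> j"
    using step.hyps Mfam_regular by (intro hat2_extension.intro) simp
  have S: "Sfam S3 (Suc j) = (\<lambda>F. hat_facet (\<M> j) (chi F)) ` Sfam S3 j \<union> {hat_facet (\<M> j) vzero}"
    using step.hyps Sfam.simps[of S3 "Suc j"] by simp
  have "supp (chi F) \<subseteq> facets (\<M> j)" if "F \<in> Sfam S3 j" for F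
  proof -
    have "F \<in> facets (\<M> j)" using that step.IH by blast
    then show ?thesis using finite_faces supp_chi by simp
  qed
  then have "Sfam S3 (Suc j) \<subseteq> facets (hat2 (\<M> j))"
    unfolding S facets_hat2 by auto
  moreover have "\<M> (Suc j) = hat2 (\<M> j)" using step.hyps by (simp add: Mfam_Suc)
  ultimately show ?case using S uncovered_hat2 step.IH by simp
qed

section \<open>The permutation $\widetilde{\rho}_0$\<close>

locale voltage_setup =
  fixes n :: nat and S3 :: "flag set set" and \<Phi>0 :: flag and c :: "flag set \<Rightarrow> flag"
  assumes n_ge_4: "4 \<le> n"
    and S3_admissible: "admissible_S3 S3"
    and base_flag: "\<Phi>0 \<in> flags (\<M> (n - 1))"
    and base_flags: "base_flag_choice n S3 \<Phi>0 c"
begin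

abbreviation N :: "flag maniplex" where
  "N \<equiv> \<M> (n - 1)"

sublocale hat2_extension "\<M> (n - 1)"
  using n_ge_4 by (intro hat2_extension.intro Mfam_regular) simp

lemma M_eq: "\<M> n = hat2 N"
  using n_ge_4 Mfam_Suc[of "n - 1"] by simp

sublocale M: regular_even_polytope "\<M> n"
  unfolding M_eq by (rule hat2_regular)

lemma rank_N [simp]: "rank N = n - 1"
  using n_ge_4 by (simp add: rank_Mfam)

lemma rank_M [simp]: "rank (\<M> n) = n"
  using n_ge_4 by (simp add: rank_Mfam)

lemma Ext_in_M: "Ext \<Psi> x \<in> flags (\<M> n) \<longleftrightarrow> \<Psi> \<in> flags N \<and> supp x \<subseteq> facets N"
  by (simp add: M_eq)

lemma flag_ME:
  assumes "\<Phi> \<in> flags (\<M> n)"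
  obtains \<Psi> x where "\<Phi> = Ext \<Psi> x" "\<Psi> \<in> flags N" "supp x \<subseteq> facets N"
  using assms unfolding M_eq by (rule flag_hat2E)

lemma nbr_M_low: "i < n - 1 \<Longrightarrow> nbr (\<M> n) i (Ext \<Psi> x) = Ext (nbr N i \<Psi>) x"
  by (simp add: M_eq)

lemma nbr_M_high: "nbr (\<M> n) (n - 1) (Ext \<Psi> x) = Ext \<Psi> (vplus x (chi (facet_of N \<Psi>)))"
  by (simp add: M_eq nbr_hat2_high)

lemma facets_M: "facets (\<M> n) = hat_facet N ` {x. supp x \<subseteq> facets N}"
  unfolding M_eq by (rule facets_hat2)

lemma chosen_flag:
  assumes "supp x \<subseteq> facets N"
  obtains \<Theta> where "\<Theta> \<in> flags N" "c (hat_facet N x) = Ext \<Theta> x"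
proof -
  have "c (hat_facet N x) \<in> hat_facet N x"
    using base_flags assms unfolding base_flag_choice_def Let_def by blast
  then show ?thesis using that by (auto simp: hat_facet_def)
qed

text \<open>The automorphism of \<open>N\<close> that $\widetilde{\rho}_0$ induces on the facet with vector \<open>x\<close>.\<close>

definition facet_reflection :: "vec \<Rightarrow> flag \<Rightarrow> flag" where
  "facet_reflection x = (SOME \<gamma>. automorphism N \<gamma> \<and>
     (\<exists>\<Theta>\<in>flags N. c (hat_facet N x) = Ext \<Theta> x \<and> \<gamma> \<Theta> = nbr N 0 \<Theta>))"

lemma facet_reflection:
  assumes "supp x \<subseteq> facets N"
  shows "automorphism N (facet_reflection x)"
    and "\<exists>\<Theta>\<in>flags N. c (hat_facet N x) = Ext \<Theta> x \<and> facet_reflection x \<Theta> = nbr N 0 \<Theta>"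
proof -
  obtain \<Theta> where \<Theta>: "\<Theta> \<in> flags N" "c (hat_facet N x) = Ext \<Theta> x"
    using assms by (rule chosen_flag)
  moreover have "nbr N 0 \<Theta> \<in> flags N" using \<Theta> n_ge_4 by (simp add: nbr_in)
  ultimately have "\<exists>\<gamma>. automorphism N \<gamma> \<and>
     (\<exists>\<Theta>\<in>flags N. c (hat_facet N x) = Ext \<Theta> x \<and> \<gamma> \<Theta> = nbr N 0 \<Theta>)"
    using flag_transitive by metis
  from someI_ex[OF this]
  show "automorphism N (facet_reflection x)"
    "\<exists>\<Theta>\<in>flags N. c (hat_facet N x) = Ext \<Theta> x \<and> facet_reflection x \<Theta> = nbr N 0 \<Theta>"
    unfolding facet_reflection_def by blast+
qed

lemma involution_of_reflection:
  assumes "automorphism N \<gamma>" "\<Theta> \<in> flags N" "\<gamma> \<Theta> = nbr N 0 \<Theta>" "\<Psi> \<in> flags N"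
  shows "\<gamma> (\<gamma> \<Psi>) = \<Psi>"
proof -
  have "0 < rank N" using n_ge_4 by simp
  moreover from this have "\<gamma> (nbr N 0 \<Theta>) = nbr N 0 (\<gamma> \<Theta>)"
    using assms by (simp add: automorphism_def del: rank_N)
  ultimately have "(\<gamma> \<circ> \<gamma>) \<Theta> = id \<Theta>" using assms nbr_nbr by simp
  then have "(\<gamma> \<circ> \<gamma>) \<Psi> = id \<Psi>"
    using automorphism_eqI automorphism_comp automorphism_id assms by blast
  then show ?thesis by simp
qed

lemma facet_reflection_in:
  "supp x \<subseteq> facets N \<Longrightarrow> \<Psi> \<in> flags N \<Longrightarrow> facet_reflection x \<Psi> \<in> flags N"
  using facet_reflection(1) automorphism_in by blast

lemma facet_reflection_twice:
  "supp x \<subseteq> facets N \<Longrightarrow> \<Psi> \<in> flags N \<Longrightarrow> facet_reflection x (facet_reflection x \<Psi>) = \<Psi>"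
  using facet_reflection involution_of_reflection by metis

definition facetwise_reflection :: "flag \<Rightarrow> flag" where
  "facetwise_reflection \<Phi> = (if \<Phi> \<in> flags (\<M> n)
     then (case \<Phi> of Sq v e \<Rightarrow> Sq v e | Ext \<Psi> x \<Rightarrow> Ext (facet_reflection x \<Psi>) x)
     else \<Phi>)"

lemma facetwise_reflection_Ext:
  "\<Psi> \<in> flags N \<Longrightarrow> supp x \<subseteq> facets N
     \<Longrightarrow> facetwise_reflection (Ext \<Psi> x) = Ext (facet_reflection x \<Psi>) x"
  by (simp add: facetwise_reflection_def Ext_in_M)

lemma facetwise_reflection_twice: "facetwise_reflection (facetwise_reflection \<Phi>) = \<Phi>"
proof (cases "\<Phi> \<in> flags (\<M> n)")
  case True
  then show ?thesis
    by (rule flag_ME)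
      (simp add: facetwise_reflection_Ext facet_reflection_in facet_reflection_twice)
qed (simp add: facetwise_reflection_def)

lemma facetwise_reflection_permutes: "facetwise_reflection permutes flags (\<M> n)"
  unfolding permutes_def
  using facetwise_reflection_twice by (metis facetwise_reflection_def)

text \<open>The conditions that define $\widetilde{\rho}_0$ determine it on the flag chosen in each
  facet, hence on the whole facet, because the facet is connected.\<close>

lemma rho0_eq: "rho0 n c = facetwise_reflection"
  unfolding rho0_def
proof (rule the_equality)
  let ?Q = "\<lambda>\<rho>. \<rho> permutes flags (\<M> n) \<and>
        (\<forall>F\<in>facets (\<M> n). \<rho> ` F = F \<and>
           (\<forall>\<Phi>\<in>F. \<forall>i\<le>n - 2. \<rho> (nbr (\<M> n) i \<Phi>) = nbr (\<M> n) i (\<rho> \<Phi>)) \<and>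
           \<rho> (c F) = nbr (\<M> n) 0 (c F))"
  have low: "i < n - 1" if "i \<le> n - 2" for i using that n_ge_4 by simp
  show "?Q facetwise_reflection"
  proof (intro conjI ballI facetwise_reflection_permutes)
    fix F assume "F \<in> facets (\<M> n)"
    then obtain x where x: "F = hat_facet N x" "supp x \<subseteq> facets N"
      unfolding facets_M by blast
    have sub: "facetwise_reflection ` F \<subseteq> F"
      using x by (auto simp: hat_facet_def facetwise_reflection_Ext facet_reflection_in)
    then have "facetwise_reflection ` facetwise_reflection ` F \<subseteq> facetwise_reflection ` F"
      by (rule image_mono)
    then show "facetwise_reflection ` F = F"
      using sub by (simp add: image_image facetwise_reflection_twice)
    show "\<forall>i\<le>n - 2.
        facetwise_reflection (nbr (\<M> n) i \<Phi>) = nbr (\<M> n) i (facetwise_reflection \<Phi>)"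
      if \<Phi>: "\<Phi> \<in> F" for \<Phi>
    proof (intro allI impI)
      fix i assume "i \<le> n - 2"
      then obtain \<Psi> where "\<Phi> = Ext \<Psi> x" "\<Psi> \<in> flags N" "i < n - 1"
        using \<Phi> x low by (auto simp: hat_facet_def)
      then show "facetwise_reflection (nbr (\<M> n) i \<Phi>) = nbr (\<M> n) i (facetwise_reflection \<Phi>)"
        using x(2) nbr_in facet_reflection(1)[OF x(2)]
        by (simp add: nbr_M_low facetwise_reflection_Ext automorphism_def)
    qed
    show "facetwise_reflection (c F) = nbr (\<M> n) 0 (c F)"
      using facet_reflection(2)[OF x(2)] x n_ge_4
      by (auto simp: facetwise_reflection_Ext nbr_M_low)
  qed
  show "\<rho> = facetwise_reflection" if Q: "?Q \<rho>" for \<rho>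
  proof
    have perm: "\<rho> permutes flags (\<M> n)" using Q by blast
    fix \<Phi>
    show "\<rho> \<Phi> = facetwise_reflection \<Phi>"
    proof (cases "\<Phi> \<in> flags (\<M> n)")
      case False
      then show ?thesis using permutes_not_in[OF perm] by (simp add: facetwise_reflection_def)
    next
      case True
      then obtain \<Psi> x where \<Psi>: "\<Phi> = Ext \<Psi> x" "\<Psi> \<in> flags N" and x: "supp x \<subseteq> facets N"
        by (rule flag_ME)
      have F: "hat_facet N x \<in> facets (\<M> n)" unfolding facets_M using x by blast
      obtain \<Theta> where \<Theta>: "\<Theta> \<in> flags N" "c (hat_facet N x) = Ext \<Theta> x"
        "facet_reflection x \<Theta> = nbr N 0 \<Theta>" using facet_reflection(2)[OF x] by blast
      have "\<rho> (Ext (act N w \<Theta>) x) = Ext (facet_reflection x (act N w \<Theta>)) x"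
        if "set w \<subseteq> {..<n - 1}" for w
        using that
      proof (induction w)
        case Nil
        have "\<rho> (c (hat_facet N x)) = nbr (\<M> n) 0 (c (hat_facet N x))" using Q F by blast
        then show ?case using \<Theta> n_ge_4 by (simp add: nbr_M_low)
      next
        case (Cons i w)
        then have i: "i < n - 1" "i \<le> n - 2" and "act N w \<Theta> \<in> flags N"
          using act_in[OF \<Theta>(1), of w] by auto
        moreover from this have "Ext (act N w \<Theta>) x \<in> hat_facet N x" by (simp add: hat_facet_def)
        then have "\<rho> (nbr (\<M> n) i (Ext (act N w \<Theta>) x)) = nbr (\<M> n) i (\<rho> (Ext (act N w \<Theta>) x))"
          using Q F i(2) by blast
        ultimately show ?case using Cons facet_reflection(1)[OF x]
          by (simp add: nbr_M_low automorphism_def)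
      qed
      moreover obtain w where "set w \<subseteq> {..<n - 1}" "\<Psi> = act N w \<Theta>"
        using connected[OF \<Theta>(1) \<Psi>(2)] by auto
      ultimately show ?thesis using \<Psi> x by (simp add: facetwise_reflection_Ext)
    qed
  qed
qed

text \<open>As $S_{n-1}$ and its images are not covered by two vertices, the base edge of the facet with a
  covered vector is the one over the fixed edge \<open>e\<close>.\<close>

definition covered :: "vec \<Rightarrow> bool" where
  "covered x \<longleftrightarrow> (\<exists>\<Phi>\<in>flags N. \<exists>\<Psi>\<in>flags N.
     supp x \<subseteq> {G. incident G (face N 0 \<Phi>) \<or> incident G (face N 0 \<Psi>)})"

lemma covered_not_special:
  assumes "covered x" "automorphism N \<gamma>"
  shows "supp x \<noteq> facet_act \<gamma> (Sfam S3 (n - 1))"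
proof
  assume eq: "supp x = facet_act \<gamma> (Sfam S3 (n - 1))"
  obtain \<Phi> \<Psi> where "\<Phi> \<in> flags N" "\<Psi> \<in> flags N"
    and cov: "supp x \<subseteq> {G. incident G (face N 0 \<Phi>) \<or> incident G (face N 0 \<Psi>)}"
    using assms(1) by (auto simp: covered_def)
  have perm: "\<gamma> permutes flags N" using assms(2) by (simp add: automorphism_def)
  have preimage: "\<exists>\<Theta>'\<in>flags N. \<gamma> \<Theta>' = \<Theta>" if "\<Theta> \<in> flags N" for \<Theta>
  proof -
    have "\<Theta> \<in> \<gamma> ` flags N" using that permutes_image[OF perm] by simp
    then show ?thesis by blast
  qed
  obtain \<Phi>' where \<Phi>': "\<Phi>' \<in> flags N" "\<gamma> \<Phi>' = \<Phi>" using preimage \<open>\<Phi> \<in> flags N\<close> by blast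
  obtain \<Psi>' where \<Psi>': "\<Psi>' \<in> flags N" "\<gamma> \<Psi>' = \<Psi>" using preimage \<open>\<Psi> \<in> flags N\<close> by blast
  have "uncovered N (Sfam S3 (n - 1))"
    using Sfam_uncovered[OF S3_admissible, of "n - 1"] n_ge_4 by simp
  then obtain F where F: "F \<in> Sfam S3 (n - 1)"
    "\<not> incident F (face N 0 \<Phi>')" "\<not> incident F (face N 0 \<Psi>')"
    using \<Phi>'(1) \<Psi>'(1) by (auto simp: uncovered_def faces_def)
  have inc: "incident (\<gamma> ` F) (face N 0 (\<gamma> \<Theta>)) \<longleftrightarrow> incident F (face N 0 \<Theta>)"
    if "\<Theta> \<in> flags N" for \<Theta>
    using permutes_inj[OF perm] automorphism_image_face[OF assms(2) that, of 0, symmetric]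
    by (simp add: incident_def flip: image_Int)
  have "\<not> incident (\<gamma> ` F) (face N 0 \<Phi>)" "\<not> incident (\<gamma> ` F) (face N 0 \<Psi>)"
    using F(2,3) inc[OF \<Phi>'(1)] inc[OF \<Psi>'(1)] \<Phi>'(2) \<Psi>'(2) by simp_all
  moreover have "\<gamma> ` F \<in> supp x" using eq F(1) by (simp add: facet_act_def)
  ultimately show False using cov by blast
qed

definition base_reflection :: "flag \<Rightarrow> flag" where
  "base_reflection = (SOME \<gamma>. automorphism N \<gamma> \<and> \<gamma> \<Phi>0 = nbr N 0 \<Phi>0)"

lemma base_reflection:
  "automorphism N base_reflection" "base_reflection \<Phi>0 = nbr N 0 \<Phi>0"
proof -
  have "nbr N 0 \<Phi>0 \<in> flags N" using base_flag n_ge_4 by (simp add: nbr_in)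
  then have "\<exists>\<gamma>. automorphism N \<gamma> \<and> \<gamma> \<Phi>0 = nbr N 0 \<Phi>0"
    using flag_transitive base_flag by blast
  from someI_ex[OF this]
  show "automorphism N base_reflection" "base_reflection \<Phi>0 = nbr N 0 \<Phi>0"
    by (simp_all add: base_reflection_def)
qed

lemma base_reflection_twice: "\<Psi> \<in> flags N \<Longrightarrow> base_reflection (base_reflection \<Psi>) = \<Psi>"
  using involution_of_reflection base_reflection base_flag by blast

text \<open>The colours that keep the base edge commute with colour 0.\<close>

lemma base_reflection_on_edge:
  assumes "\<Psi> \<in> face N 1 \<Phi>0"
  shows "base_reflection \<Psi> = nbr N 0 \<Psi>"
proof -
  obtain w where w: "set w \<subseteq> {..<rank N} - {1}" "\<Psi> = act N w \<Phi>0"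
    using assms face_eq[OF base_flag] by auto
  then have "set w \<subseteq> {..<rank N}" "1 \<notin> set w" by auto
  then show ?thesis
    using w(2) automorphism_act[OF base_reflection(1) base_flag] act_nbr_0[OF base_flag]
      base_reflection(2) by simp
qed

text \<open>The chosen flag has its 1-face over \<open>e\<close>, where \<open>base_reflection\<close> also acts as colour 0; two
  automorphisms that agree on a flag are equal.\<close>

lemma rho0_covered:
  assumes "covered x" "supp x \<subseteq> facets N" "\<Psi> \<in> flags N"
  shows "rho0 n c (Ext \<Psi> x) = Ext (base_reflection \<Psi>) x"
proof -
  obtain \<Theta> where \<Theta>: "\<Theta> \<in> flags N" "c (hat_facet N x) = Ext \<Theta> x"
    "facet_reflection x \<Theta> = nbr N 0 \<Theta>" using facet_reflection(2)[OF assms(2)] by blast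
  have "\<not> (\<exists>\<gamma>. automorphism N \<gamma> \<and> supp x = facet_act \<gamma> (Sfam S3 (n - 1)))"
    using covered_not_special[OF assms(1)] by blast
  then have "base_edge n S3 \<Phi>0 x = hat_face N (face N 1 \<Phi>0) x"
    unfolding base_edge_def Let_def by (rule if_not_P)
  then have "face (\<M> n) 1 (Ext \<Theta> x) = hat_face N (face N 1 \<Phi>0) x"
    using base_flags assms(2) \<Theta>(2) unfolding base_flag_choice_def Let_def by metis
  then have "\<Theta> \<in> face N 1 \<Phi>0"
    using M.face_refl[of "Ext \<Theta> x" 1] by (auto simp: hat_face_def)
  then have "facet_reflection x \<Theta> = base_reflection \<Theta>"
    using base_reflection_on_edge \<Theta>(3) by simp
  then have "facet_reflection x \<Psi> = base_reflection \<Psi>"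
    using automorphism_eqI facet_reflection(1) base_reflection(1) \<Theta>(1) assms by blast
  then show ?thesis using assms by (simp add: rho0_eq facetwise_reflection_Ext)
qed

section \<open>Words in the generators and $\widetilde{\rho}_0$\<close>

definition gen :: "nat \<Rightarrow> flag \<Rightarrow> flag" where
  "gen i = (if i = n then rho0 n c else monodromy_gen (\<M> n) i)"

lemma gen_low: "i < n \<Longrightarrow> \<Phi> \<in> flags (\<M> n) \<Longrightarrow> gen i \<Phi> = nbr (\<M> n) i \<Phi>"
  by (simp add: gen_def monodromy_gen_def)

lemma gen_outside: "\<Phi> \<notin> flags (\<M> n) \<Longrightarrow> gen i \<Phi> = \<Phi>"
  by (simp add: gen_def monodromy_gen_def rho0_eq facetwise_reflection_def)

lemma gen_gen: "i \<le> n \<Longrightarrow> gen i (gen i \<Phi>) = \<Phi>"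
  by (cases "i = n"; cases "\<Phi> \<in> flags (\<M> n)")
    (simp_all add: gen_def monodromy_gen_def M.nbr_in M.nbr_nbr rho0_eq facetwise_reflection_twice)

lemma gen_0_gen_n: "gen 0 (gen n \<Phi>) = gen n (gen 0 \<Phi>)"
proof (cases "\<Phi> \<in> flags (\<M> n)")
  case True
  then obtain \<Psi> x where \<Psi>: "\<Phi> = Ext \<Psi> x" "\<Psi> \<in> flags N" "supp x \<subseteq> facets N"
    by (rule flag_ME)
  have "facet_reflection x (nbr N 0 \<Psi>) = nbr N 0 (facet_reflection x \<Psi>)"
    using facet_reflection(1)[OF \<Psi>(3)] \<Psi>(2) n_ge_4 by (simp add: automorphism_def)
  then show ?thesis using \<Psi> n_ge_4 nbr_in[of \<Psi> 0] facet_reflection_in[of x \<Psi>]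
    by (simp add: gen_def monodromy_gen_def Ext_in_M nbr_M_low rho0_eq facetwise_reflection_Ext)
qed (simp add: gen_outside)

lemma gens_low:
  "set w \<subseteq> {..<n} \<Longrightarrow> \<Phi> \<in> flags (\<M> n) \<Longrightarrow> foldr gen w \<Phi> = act (\<M> n) w \<Phi>"
  using M.act_in[of \<Phi>] by (induction w) (auto simp: gen_low)

lemma gens_outside: "\<Phi> \<notin> flags (\<M> n) \<Longrightarrow> foldr gen w \<Phi> = \<Phi>"
  by (induction w) (auto simp: gen_outside)

abbreviation (input) N_part :: "nat list \<Rightarrow> nat list" where
  "N_part \<equiv> filter (\<lambda>i. i < n - 1)"

text \<open>Colours from 2 on keep the vertex, and the reflection swaps the vertices of \<open>\<Phi>\<close> and of its
  mirror image. So the vector remains covered by these two vertices, and every occurrence of \<open>n\<close>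
  acts on the flag of \<open>N\<close> as the same reflection, which commutes with the generators of \<open>N\<close>.\<close>

lemma gens_from_zero:
  assumes \<Phi>: "\<Phi> \<in> flags N" and "set v \<subseteq> {2..n}"
  shows "\<exists>z. foldr gen v (Ext \<Phi> vzero) =
      Ext ((if odd (count_list v n) then base_reflection else id) (act N (N_part v) \<Phi>)) z \<and>
    supp z \<subseteq> facets N \<and>
    supp z \<subseteq> {G. incident G (face N 0 \<Phi>) \<or> incident G (face N 0 (base_reflection \<Phi>))}"
  using assms(2)
proof (induction v)
  case Nil
  show ?case by (intro exI[of _ vzero]) simp
next
  case (Cons i v)
  let ?p = "act N (N_part v) \<Phi>"
  let ?q = "(if odd (count_list v n) then base_reflection else id) ?p"
  let ?A = "{G. incident G (face N 0 \<Phi>) \<or> incident G (face N 0 (base_reflection \<Phi>))}"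
  obtain z where z: "foldr gen v (Ext \<Phi> vzero) = Ext ?q z" "supp z \<subseteq> facets N" "supp z \<subseteq> ?A"
    using Cons by auto
  have \<Phi>': "base_reflection \<Phi> \<in> flags N" using automorphism_in base_reflection(1) \<Phi> by blast
  then have cov: "covered z" using z(3) \<Phi> by (auto simp: covered_def)
  have w: "set (N_part v) \<subseteq> {..<rank N}" "0 \<notin> set (N_part v)" using Cons.prems by auto
  have p: "?p \<in> flags N" using act_in \<Phi> w by blast
  then have q: "?q \<in> flags N" using automorphism_in base_reflection(1) by simp
  consider "i < n - 1" "i \<noteq> n" | "i = n - 1" "i \<noteq> n" | "i = n"
    using Cons.prems by fastforce
  then show ?case
  proof cases
    case 1
    then have "nbr N i ?q = (if odd (count_list v n) then base_reflection else id) (nbr N i ?p)"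
      using p base_reflection(1) by (simp add: automorphism_def)
    moreover have "gen i (Ext ?q z) = Ext (nbr N i ?q) z"
      using 1 q z(2) by (simp add: gen_low Ext_in_M nbr_M_low)
    ultimately show ?thesis using 1 z by (intro exI[of _ z]) simp
  next
    case 2
    have "?p \<in> face N 0 \<Phi>" using act_in_face[OF \<Phi> w] .
    moreover have "base_reflection ?p \<in> face N 0 (base_reflection \<Phi>)"
      using act_in_face[OF \<Phi>' w] automorphism_act[OF base_reflection(1) \<Phi> w(1)] by simp
    ultimately have "?q \<in> face N 0 \<Phi> \<or> ?q \<in> face N 0 (base_reflection \<Phi>)" by simp
    then have "facet_of N ?q \<in> ?A"
      using face_refl[of ?q "rank N - 1"] unfolding incident_def by blast
    then have "supp (vplus z (chi (facet_of N ?q))) \<subseteq> ?A"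
      "supp (vplus z (chi (facet_of N ?q))) \<subseteq> facets N"
      using z(2,3) supp_chi_facet[OF q] facet_of_in[OF q] by (auto simp: supp_vplus)
    moreover have "gen i (Ext ?q z) = Ext ?q (vplus z (chi (facet_of N ?q)))"
      using 2 q z(2) n_ge_4 by (simp add: gen_low Ext_in_M nbr_M_high)
    ultimately show ?thesis using 2 z
      by (intro exI[of _ "vplus z (chi (facet_of N ?q))"]) simp
  next
    case 3
    then have "gen i (Ext ?q z) = Ext (base_reflection ?q) z"
      using rho0_covered[OF cov z(2) q] by (simp add: gen_def)
    moreover have "\<not> n < n - 1" by simp
    ultimately show ?thesis using 3 z base_reflection_twice[OF p]
      by (intro exI[of _ z]) simp
  qed
qed

text \<open>The letters from 2 to \<open>n - 1\<close> keep the base edge and commute with colour 0, and colour 0 is how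
  the reflection acts on this edge.\<close>

lemma gens_from_base_flag:
  assumes "set v \<subseteq> {2..n}"
  shows "foldr gen v (Ext \<Phi>0 vzero) =
    (if odd (count_list v n) then nbr (\<M> n) 0 else id)
      (act (\<M> n) (filter (\<lambda>i. i < n) v) (Ext \<Phi>0 vzero))"
  using assms
proof (induction v)
  case (Cons i v)
  let ?s = "act (\<M> n) (filter (\<lambda>i. i < n) v) (Ext \<Phi>0 vzero)"
  have "Ext \<Phi>0 vzero \<in> flags (\<M> n)" using base_flag by (simp add: Ext_in_M)
  then have s: "?s \<in> flags (\<M> n)" by (rule M.act_in) auto
  then have s0: "nbr (\<M> n) 0 ?s \<in> flags (\<M> n)" using M.nbr_in n_ge_4 by simp
  have IH: "foldr gen v (Ext \<Phi>0 vzero) = (if odd (count_list v n) then nbr (\<M> n) 0 else id) ?s"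
    using Cons by simp
  show ?case
  proof (cases "i = n")
    case False
    then have "2 \<le> i" "i < n" using Cons.prems by auto
    then show ?thesis using IH s s0 M.nbr_commute[OF s, of 0 i] by (simp add: gen_low)
  next
    case True
    let ?p = "act N (N_part v) \<Phi>0"
    let ?q = "(if odd (count_list v n) then base_reflection else id) ?p"
    obtain z where z: "foldr gen v (Ext \<Phi>0 vzero) = Ext ?q z" "supp z \<subseteq> facets N"
      "supp z \<subseteq> {G. incident G (face N 0 \<Phi>0) \<or> incident G (face N 0 (base_reflection \<Phi>0))}"
      using gens_from_zero[OF base_flag, of v] Cons.prems by auto
    have "base_reflection \<Phi>0 \<in> flags N"
      using automorphism_in base_reflection(1) base_flag by blast
    then have cov: "covered z" using z(3) base_flag by (auto simp: covered_def)
    have "set (N_part v) \<subseteq> {..<rank N}" "1 \<notin> set (N_part v)" using Cons.prems by auto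
    then have p: "?p \<in> flags N" "?p \<in> face N 1 \<Phi>0"
      using act_in act_in_face base_flag by blast+
    then have "face N 1 (nbr N 0 ?p) = face N 1 \<Phi>0"
      using face_nbr[of ?p 0 1] face_of_mem[OF base_flag] n_ge_4 by simp
    then have "nbr N 0 ?p \<in> face N 1 \<Phi>0" using face_refl by blast
    then have q: "?q \<in> flags N" "?q \<in> face N 1 \<Phi>0"
      using p base_reflection_on_edge nbr_in n_ge_4 by simp_all
    have "gen i (Ext ?q z) = nbr (\<M> n) 0 (Ext ?q z)"
      using rho0_covered[OF cov z(2) q(1)] base_reflection_on_edge[OF q(2)] True n_ge_4
      by (simp add: gen_def nbr_M_low)
    then have "foldr gen (i # v) (Ext \<Phi>0 vzero) =
        nbr (\<M> n) 0 ((if odd (count_list v n) then nbr (\<M> n) 0 else id) ?s)"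
      using z(1) IH by simp
    then show ?thesis using True M.nbr_nbr[OF s] n_ge_4 by simp
  qed
qed simp

text \<open>With an odd number of reflections, \<open>base_reflection\<close> would be at once an automorphism and the
  action of a word, that is, of colour 0. But colour 0 is not an automorphism, as it does not
  commute with colour 1.\<close>

lemma even_number_of_reflections:
  assumes w: "set w \<subseteq> {..<n}" and v: "set v \<subseteq> {2..n}" and eq: "foldr gen w = foldr gen v"
  shows "even (count_list v n)"
proof (rule ccontr)
  assume odd: "odd (count_list v n)"
  let ?u = "N_part w @ rev (N_part v)"
  have len: "set ?u \<subseteq> {..<rank N}" "set [0] \<subseteq> {..<rank N}" using n_ge_4 by auto
  have act_u: "act N ?u \<Psi> = base_reflection \<Psi>" if \<Psi>: "\<Psi> \<in> flags N" for \<Psi>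
  proof -
    let ?\<Phi> = "act N (rev (N_part v)) \<Psi>"
    have \<Phi>: "?\<Phi> \<in> flags N" using \<Psi> by (rule act_in) auto
    obtain z where "foldr gen v (Ext ?\<Phi> vzero) = Ext (base_reflection (act N (N_part v) ?\<Phi>)) z"
      using gens_from_zero[OF \<Phi> v] odd by auto
    moreover have "foldr gen w (Ext ?\<Phi> vzero) = act (\<M> n) w (Ext ?\<Phi> vzero)"
      using w \<Phi> by (simp add: gens_low Ext_in_M)
    moreover obtain z' where "act (\<M> n) w (Ext ?\<Phi> vzero) = Ext (act N (N_part w) ?\<Phi>) z'"
      using act_hat2_fst[of N w ?\<Phi> vzero] unfolding M_eq by auto
    ultimately have "act N (N_part w) ?\<Phi> = base_reflection (act N (N_part v) ?\<Phi>)"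
      using eq by simp
    moreover have "act N (N_part v) ?\<Phi> = \<Psi>" using \<Psi> by (rule act_rev') auto
    ultimately show ?thesis by simp
  qed
  have "act N ?u \<Phi>0 = act N [0] \<Phi>0" using act_u base_flag base_reflection(2) by simp
  then have r: "base_reflection \<Psi> = nbr N 0 \<Psi>" if "\<Psi> \<in> flags N" for \<Psi>
    using act_eq_everywhere[OF base_flag len] act_u that by simp
  have "nbr N 1 \<Phi>0 \<in> flags N" using nbr_in base_flag n_ge_4 by simp
  moreover have "base_reflection (nbr N 1 \<Phi>0) = nbr N 1 (base_reflection \<Phi>0)"
    using base_reflection(1) base_flag n_ge_4 by (simp add: automorphism_def)
  ultimately show False using r base_flag nbr_0_1_not_commute by metis
qed

text \<open>Both words act at the base flag like words in the generators of \<open>\<M> n\<close>, so the meet property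
  applies; regularity carries the equation over to all flags.\<close>

lemma gens_meet:
  assumes w: "set w \<subseteq> {0..m}" and v: "set v \<subseteq> {k..n}" and eq: "foldr gen w = foldr gen v"
    and "m < n" "2 \<le> k"
  shows "\<exists>u. set u \<subseteq> {k..m} \<and> foldr gen u = foldr gen w \<and>
    (\<forall>P. even (length (filter P u)) = even (length (filter P w)))"
proof -
  let ?b = "Ext \<Phi>0 vzero"
  have b: "?b \<in> flags (\<M> n)" using base_flag by (simp add: Ext_in_M)
  have w': "set w \<subseteq> {..<rank (\<M> n)}" "set w \<subseteq> {..m}" and v': "set v \<subseteq> {2..n}"
    using w v \<open>m < n\<close> \<open>2 \<le> k\<close> by auto
  have "even (count_list v n)"
    using w' v' eq by (intro even_number_of_reflections[of w]) simp_all
  then have "act (\<M> n) w ?b = act (\<M> n) (filter (\<lambda>i. i < n) v) ?b"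
    using gens_from_base_flag[OF v'] gens_low[OF _ b, of w] w' eq by simp
  moreover have "set (filter (\<lambda>i. i < n) v) \<subseteq> {k..<rank (\<M> n)}" using v by auto
  ultimately obtain u where u: "set u \<subseteq> {k..m}" "set u \<subseteq> {..<rank (\<M> n)}"
    and eq_b: "act (\<M> n) u ?b = act (\<M> n) w ?b"
    using M.meet_property[OF b w'] by blast
  have "foldr gen u \<Phi> = foldr gen w \<Phi>" for \<Phi>
  proof (cases "\<Phi> \<in> flags (\<M> n)")
    case True
    then show ?thesis
      using M.act_eq_everywhere[OF b u(2) w'(1) eq_b] u(2) w'(1) by (simp add: gens_low)
  qed (simp add: gens_outside)
  moreover have "even (length (filter P u)) = even (length (filter P w))" for P
    by (rule M.even_length_filter_eq[OF b u(2) w'(1) eq_b])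
  ultimately show ?thesis using u(1) by blast
qed

end

section \<open>Voltages of paths\<close>

definition endpoint :: "nat set \<Rightarrow> vertex \<Rightarrow> nat list \<Rightarrow> vertex" where
  "endpoint I a u = (if even (length (filter (\<lambda>i. i \<notin> I) u)) then a else opposite a)"

lemma opposite_opposite [simp]: "opposite (opposite a) = a"
  by (cases a) simp_all

lemma endpoint_Cons: "endpoint I a (i # u) = endpoint I (dart_end I (a, i)) u"
  by (simp add: endpoint_def dart_end_def)

lemma is_walk_endpoint: "is_walk n I a w b \<Longrightarrow> endpoint I a (map snd w) = b"
proof (induction w arbitrary: a)
  case Nil
  then show ?case by (simp add: endpoint_def)
next
  case (Cons d w)
  then show ?case by (cases d) (simp add: endpoint_Cons)
qed

lemma is_walk_darts: "is_walk n I a w b \<Longrightarrow> set w \<subseteq> darts n"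
  by (induction w arbitrary: a) auto

lemma walk_with_colours:
  "set u \<subseteq> {0..n} \<Longrightarrow> \<exists>w. map snd w = u \<and> is_walk n I a w (endpoint I a u)"
proof (induction u arbitrary: a)
  case Nil
  show ?case by (simp add: endpoint_def)
next
  case (Cons i u)
  then obtain w where "map snd w = u" "is_walk n I (dart_end I (a, i)) w (endpoint I a (i # u))"
    using Cons.IH[of "dart_end I (a, i)"] by (auto simp: endpoint_Cons)
  then show ?case using Cons.prems by (intro exI[of _ "(a, i) # w"]) (simp add: darts_def)
qed

lemma walk_voltage_append:
  "walk_voltage n I c (u @ v) = walk_voltage n I c u \<circ> walk_voltage n I c v"
  by (induction u) (simp_all add: rprod_def comp_assoc)

locale voltage_graph = voltage_setup +
  fixes I :: "nat set"
  assumes zero_link: "0 \<notin> I" and top_link: "n \<notin> I"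
begin

text \<open>The voltage assignment differs from \<open>gen\<close>, which depends on the colour of a dart only, by a
  change of potential at the black vertex.\<close>

definition potential :: "vertex \<Rightarrow> flag \<Rightarrow> flag" where
  "potential a = (case a of White \<Rightarrow> id | Black \<Rightarrow> gen 0)"

lemma potential_twice: "potential a (potential a \<Phi>) = \<Phi>"
  by (cases a) (simp_all add: potential_def gen_gen)

text \<open>For colour \<open>n\<close> both darts have the same voltage because colour 0 commutes with
  $\widetilde{\rho}_0$.\<close>

lemma voltage_eq:
  assumes "d \<in> darts n"
  shows "voltage n I c d = potential (fst d) \<circ> gen (snd d) \<circ> potential (dart_end I d)"
proof -
  obtain s i where d: "d = (s, i)" "i \<le> n" using assms by (auto simp: darts_def)
  have n: "n \<noteq> 0" "gen 0 = monodromy_gen (\<M> n) 0" using n_ge_4 by (auto simp: gen_def)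
  show ?thesis
  proof (cases "i = 0 \<or> i = n")
    case True
    then show ?thesis
      using d zero_link top_link n_ge_4 gen_0_gen_n gen_gen[of 0]
      by (cases s) (auto simp: voltage_def Let_def dart_end_def potential_def fun_eq_iff y_perm_def
          rprod_def n gen_def[of n])
  next
    case False
    then have "gen i = monodromy_gen (\<M> n) i" by (simp add: gen_def)
    then show ?thesis
      using d False
      by (cases s) (auto simp: voltage_def Let_def dart_end_def potential_def fun_eq_iff rprod_def n)
  qed
qed

lemma walk_voltage_eq:
  "is_walk n I a w b \<Longrightarrow>
     walk_voltage n I c w = potential a \<circ> foldr gen (map snd w) \<circ> potential b"
  by (induction w arbitrary: a) (auto simp: fun_eq_iff potential_twice rprod_def voltage_eq)

lemma voltage_dart_inv:
  assumes "d \<in> darts n"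
  shows "voltage n I c d \<circ> voltage n I c (dart_inv I d) = id"
proof -
  have "dart_inv I d \<in> darts n" "snd d \<le> n" "dart_end I (dart_inv I d) = fst d"
    using assms by (auto simp: darts_def dart_inv_def dart_end_def)
  then show ?thesis
    using assms by (auto simp: voltage_eq fun_eq_iff dart_inv_def potential_twice gen_gen)
qed

lemma homotopic_walk_voltage:
  "(w, w') \<in> homotopy n I a b \<Longrightarrow> walk_voltage n I c w = walk_voltage n I c w'"
  unfolding homotopy_def Let_def
proof (induction rule: rtrancl_induct)
  case (step w' w'')
  have "walk_voltage n I c (u @ v) = walk_voltage n I c (u @ [d, dart_inv I d] @ v)"
    if "is_walk n I a (u @ [d, dart_inv I d] @ v) b" for u d v
  proof -
    have "d \<in> darts n" using is_walk_darts[OF that] by auto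
    from voltage_dart_inv[OF this]
    have "walk_voltage n I c [d, dart_inv I d] = id" by (simp add: rprod_def)
    then show ?thesis by (simp only: walk_voltage_append comp_id id_comp)
  qed
  then have "walk_voltage n I c w' = walk_voltage n I c w''" using step.hyps(2) by auto
  then show ?case using step.IH by simp
qed simp

text \<open>Homotopic walks have equal voltage, and every word in the colours up to \<open>n\<close> is the sequence of
  colours of one walk from \<open>a\<close>.\<close>

lemma voltages_paths:
  assumes "J \<subseteq> {0..n}"
  shows "voltages n I c (paths n I a b J) =
    {potential a \<circ> foldr gen u \<circ> potential b | u. set u \<subseteq> J \<and> endpoint I a u = b}"
proof -
  have "voltages n I c (paths n I a b J) =
      {walk_voltage n I c w | w. is_walk n I a w b \<and> snd ` set w \<subseteq> J}"
  proof (intro equalityI subsetI)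
    fix \<alpha> assume "\<alpha> \<in> voltages n I c (paths n I a b J)"
    then obtain C w' where "C \<in> paths n I a b J" and w': "w' \<in> C" "\<alpha> = walk_voltage n I c w'"
      unfolding voltages_def by (elim UN_E imageE)
    then obtain w where w: "is_walk n I a w b" "snd ` set w \<subseteq> J"
      "C = homotopy n I a b `` {w}"
      unfolding paths_def by (elim CollectE exE conjE)
    then have "(w, w') \<in> homotopy n I a b" using w'(1) by simp
    then show "\<alpha> \<in> {walk_voltage n I c w | w. is_walk n I a w b \<and> snd ` set w \<subseteq> J}"
      using homotopic_walk_voltage w w'(2) by (intro CollectI exI[of _ w]) simp
  next
    fix \<alpha> assume "\<alpha> \<in> {walk_voltage n I c w | w. is_walk n I a w b \<and> snd ` set w \<subseteq> J}"
    then obtain w where "is_walk n I a w b" "snd ` set w \<subseteq> J" "\<alpha> = walk_voltage n I c w" by blast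
    moreover from this have "homotopy n I a b `` {w} \<in> paths n I a b J"
      unfolding paths_def by blast
    moreover have "w \<in> homotopy n I a b `` {w}" by (simp add: homotopy_def Let_def)
    ultimately show "\<alpha> \<in> voltages n I c (paths n I a b J)"
      unfolding voltages_def by (intro UN_I image_eqI[of \<alpha> _ w])
  qed
  also have "\<dots> = {potential a \<circ> foldr gen u \<circ> potential b | u. set u \<subseteq> J \<and> endpoint I a u = b}"
  proof (intro equalityI subsetI)
    fix \<alpha> assume "\<alpha> \<in> {walk_voltage n I c w | w. is_walk n I a w b \<and> snd ` set w \<subseteq> J}"
    then obtain w where "is_walk n I a w b" "snd ` set w \<subseteq> J" "\<alpha> = walk_voltage n I c w" by blast
    then show "\<alpha> \<in> {potential a \<circ> foldr gen u \<circ> potential b | u. set u \<subseteq> J \<and> endpoint I a u = b}"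
      using walk_voltage_eq is_walk_endpoint by (intro CollectI exI[of _ "map snd w"]) simp
  next
    fix \<alpha> assume "\<alpha> \<in> {potential a \<circ> foldr gen u \<circ> potential b | u. set u \<subseteq> J \<and> endpoint I a u = b}"
    then obtain u where u: "set u \<subseteq> J" "endpoint I a u = b" "\<alpha> = potential a \<circ> foldr gen u \<circ> potential b"
      by blast
    obtain w where "map snd w = u" "is_walk n I a w b"
      using walk_with_colours[of u n I a] assms u by blast
    moreover from this u(1) have "snd ` set w \<subseteq> J" by (simp flip: set_map)
    ultimately show "\<alpha> \<in> {walk_voltage n I c w | w. is_walk n I a w b \<and> snd ` set w \<subseteq> J}"
      using u(3) walk_voltage_eq by (intro CollectI exI[of _ w]) simp
  qed
  finally show ?thesis .
qed

lemma potential_cancel: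
  assumes "potential a \<circ> f \<circ> potential b = potential a \<circ> g \<circ> potential b"
  shows "f = g"
proof
  fix \<Phi>
  have "potential a (f (potential b (potential b \<Phi>))) = potential a (g (potential b (potential b \<Phi>)))"
    using fun_cong[OF assms, of "potential b \<Phi>"] by simp
  then show "f \<Phi> = g \<Phi>" by (metis potential_twice)
qed

end

theorem theorem6p4:
  fixes n k m :: nat and I :: "nat set" and S3 :: "flag set set"
    and \<Phi>0 :: flag and c :: "flag set \<Rightarrow> flag" and a b :: vertex
  assumes "n \<ge> 4"
    and "I \<subseteq> {0..n}" and "0 \<notin> I" and "n \<notin> I"
    and "admissible_S3 S3"
    and "\<Phi>0 \<in> flags (\<M> (n - 1))"
    and "base_flag_choice n S3 \<Phi>0 c"
    and "1 < k" and "k \<le> n" and "m \<le> n"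
  shows "voltages n I c (paths n I a b {0..m}) \<inter> voltages n I c (paths n I a b {k..n})
       = voltages n I c (paths n I a b {k..m})"
proof -
  interpret voltage_graph n S3 \<Phi>0 c I
    using assms by (intro voltage_graph.intro voltage_setup.intro voltage_graph_axioms.intro)
  let ?V = "\<lambda>J. {potential a \<circ> foldr gen u \<circ> potential b | u. set u \<subseteq> J \<and> endpoint I a u = b}"
  have "?V {0..m} \<inter> ?V {k..n} = ?V {k..m}"
  proof (intro equalityI subsetI)
    fix \<alpha> assume "\<alpha> \<in> ?V {0..m} \<inter> ?V {k..n}"
    then obtain w v where w: "set w \<subseteq> {0..m}" "endpoint I a w = b"
      and \<alpha>: "\<alpha> = potential a \<circ> foldr gen w \<circ> potential b"
      and v: "set v \<subseteq> {k..n}" "endpoint I a v = b"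
      and \<alpha>': "\<alpha> = potential a \<circ> foldr gen v \<circ> potential b" by blast
    have eq: "foldr gen w = foldr gen v" using \<alpha> \<alpha>' potential_cancel by metis
    show "\<alpha> \<in> ?V {k..m}"
    proof (cases "m = n")
      case True
      then show ?thesis using v \<alpha>' by blast
    next
      case False
      then obtain u where u: "set u \<subseteq> {k..m}" "foldr gen u = foldr gen w"
        and parity: "\<And>P. even (length (filter P u)) = even (length (filter P w))"
        using gens_meet[OF w(1) v(1) eq] assms by auto
      have "endpoint I a u = b" using w(2) parity by (simp add: endpoint_def)
      then show ?thesis using u \<alpha> by (intro CollectI exI[of _ u]) simp
    qed
  next
    fix \<alpha> assume "\<alpha> \<in> ?V {k..m}"
    moreover have "{k..m} \<subseteq> {0..m}" "{k..m} \<subseteq> {k..n}" using assms by auto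
    ultimately show "\<alpha> \<in> ?V {0..m} \<inter> ?V {k..n}" by blast
  qed
  moreover have "{0..m} \<subseteq> {0..n}" "{k..n} \<subseteq> {0..n}" "{k..m} \<subseteq> {0..n}"
    using assms by auto
  ultimately show ?thesis by (simp only: voltages_paths)
qed

end
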